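(* Let $d\ge1$ and $n\ge 3$. The number of fully commutative elements of $G(d,1,n)$ is equal to $$\sum_{k=0}^n C(n,k)\,|\mathcal P(n,k)| = d(d-1)\,\mathfrak F_{n,n-2}(d)+(2d-1)\,C_n-(d-1),$$ where $|\mathcal P(n,k)|$ is the number of collections in the packet $\mathcal P(n,k)$ of $G(d,1,n)$.
   Context: Numbers: $C(n,k)=\frac{(n+k)!\,(n-k+1)}{k!\,(n+1)!}$ for $0\le k\le n$ (Catalan triangle numbers); $C_n=\frac1{n+1}\binom{2n}{n}$; $\mathfrak F_{n,k}(x)=\sum_{s=0}^{k}C(n,s)x^{k-s}$ for $0\le k\le n$ (Catalan triangle polynomial). Group: for positive integers $d,n$, $G(d,1,n)$ is the group generated by $s_1,\dots,s_n$ with defining relations $s_n^d=1$; $s_i^2=1$ $(1\le i\le n-1)$; $s_is_j=s_js_i$ $(j+1<i\le n)$; $s_{i+1}s_is_{i+1}=s_is_{i+1}s_i$ $(1\le i\le n-2)$; $s_ns_{n-1}s_ns_{n-1}=s_{n-1}s_ns_{n-1}s_n$. Canonical words: words are elements of the free monoid on $\{s_1,\dots,s_n\}$. Put $s_{ij}=s_is_{i-1}\cdots s_j$ if $i>j$, $s_{ii}=s_i$, $s_{ij}=$ the empty word if $i<j$; and $s^{(k)}_{nj}=s_n^k s_{n-1,j}$ for $k\ge1$, $1\le j\le n$. Every element of $G(d,1,n)$ has a unique canonical (reduced) word $s_{1i_1}s_{2i_2}\cdots s_{n-1,i_{n-1}}\,s^{(k_1)}_{nj_1}\cdots s^{(k_\ell)}_{nj_\ell}$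 with $1\le i_p\le p+1$ for $1\le p\le n-1$, $\ell\ge0$, $1\le j_1<\cdots<j_\ell\le n$, $1\le k_p\le d-1$. The set of canonical words is $\mathcal W(d,1,n)$. The left factor $s_{1i_1}\cdots s_{n-1,i_{n-1}}$ is the prefix and the right factor $s^{(k_1)}_{nj_1}\cdots s^{(k_\ell)}_{nj_\ell}$ is the suffix. Full commutativity: a reduced expression for $w$ is a word in the generators of minimal length representing $w$; $R(w)$ is the set of these. $w$ is fully commutative if any element of $R(w)$ can be obtained from any other using only the commutations $s_is_j=s_js_i$ $(j+1<i\le n)$ on adjacent letters. A canonical word is fully commutative if the element it represents is. Collections: for a suffix $\boldsymbol w'$, the collection $\mathbf c^n_{\boldsymbol w'}$ is the set of fully commutative words in $\mathcal W(d,1,n)$ whose suffix is $\boldsymbol w'$. Packets: $\mathcal P(n,k)$, $0\le k\le n$, is the following set of collections (all exponents $t,t_i$ range over $1,\dots,d-1$). $\mathcal P(n,0)$: collections labeled by suffixes $s^{(t_1)}_{n1}s^{(t_2)}_{nj_2}\cdots s^{(t_\ell)}_{nj_\ell}$ with $\ell\ge2$ and $1<j_2<\cdots<j_\ell\le n$. $\mathcal P(n,k)$ for $1\le k\le n-2$: collections labeled by $s^{(t)}_{nk}$ or by $s^{(t_1)}_{n,k+1}s^{(t_2)}_{nj_2}\cdots s^{(t_\ell)}_{nj_\ell}$ with $\ell\ge2$ and $k+1<j_2<\cdots<j_\ell\le n$. $\mathcal P(n,n-1)$: collections labeled by $s_n^t$ or $s^{(t)}_{n,n-1}=s_n^ts_{n-1}$.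 $\mathcal P(n,n)$: only the collection labeled by the empty suffix. *)

theory Defs
  imports "HOL-Algebra.Group" "HOL-Computational_Algebra.Polynomial"
begin

section \<open>Groups given by generators and relations\<close>

text \<open>A signed letter \<open>(a, True)\<close> stands for the generator \<open>a\<close> and \<open>(a, False)\<close> for its formal
  inverse. A pair \<open>(x, y)\<close> of positive words in \<open>R\<close> stands for the defining relation \<open>x = y\<close>.\<close>

definition signed_words :: "'a set \<Rightarrow> ('a \<times> bool) list set" where
  "signed_words S = lists (S \<times> UNIV)"

definition positive :: "'a list \<Rightarrow> ('a \<times> bool) list" where
  "positive w = map (\<lambda>a. (a, True)) w"

inductive_set presented_rel ::
    "'a set \<Rightarrow> ('a list \<times> 'a list) set \<Rightarrow> (('a \<times> bool) list \<times> ('a \<times> bool) list) set"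
  for S :: "'a set" and R :: "('a list \<times> 'a list) set"
where
  refl: "w \<in> signed_words S \<Longrightarrow> (w, w) \<in> presented_rel S R"
| sym: "(v, w) \<in> presented_rel S R \<Longrightarrow> (w, v) \<in> presented_rel S R"
| trans: "(u, v) \<in> presented_rel S R \<Longrightarrow> (v, w) \<in> presented_rel S R \<Longrightarrow> (u, w) \<in> presented_rel S R"
| cancel: "u \<in> signed_words S \<Longrightarrow> v \<in> signed_words S \<Longrightarrow> a \<in> S \<Longrightarrow>
    (u @ [(a, b), (a, \<not> b)] @ v, u @ v) \<in> presented_rel S R"
| relator: "u \<in> signed_words S \<Longrightarrow> v \<in> signed_words S \<Longrightarrow>
    x \<in> lists S \<Longrightarrow> y \<in> lists S \<Longrightarrow> (x, y) \<in> R \<Longrightarrow>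
    (u @ positive x @ v, u @ positive y @ v) \<in> presented_rel S R"

definition presented_group ::
    "'a set \<Rightarrow> ('a list \<times> 'a list) set \<Rightarrow> ('a \<times> bool) list set monoid" where
  "presented_group S R =
    \<lparr> carrier = signed_words S // presented_rel S R,
      monoid.mult = (\<lambda>A B. \<Union>u\<in>A. \<Union>v\<in>B. presented_rel S R `` {u @ v}),
      monoid.one = presented_rel S R `` {[]} \<rparr>"

lemma presented_rel_words:
  "(u, v) \<in> presented_rel S R \<Longrightarrow> u \<in> signed_words S \<and> v \<in> signed_words S"
  by (induction rule: presented_rel.induct) (auto simp: signed_words_def positive_def)

lemma equiv_presented_rel: "equiv (signed_words S) (presented_rel S R)"
proof (rule equivI)
  show "presented_rel S R \<subseteq> signed_words S \<times> signed_words S"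
    by (auto dest: presented_rel_words)
  show "refl_on (signed_words S) (presented_rel S R)"
    by (auto intro!: refl_onI presented_rel.refl)
  show "sym (presented_rel S R)"
    by (rule symI) (rule presented_rel.sym)
  show "trans (presented_rel S R)"
    by (rule transI) (rule presented_rel.trans)
qed

lemma presented_rel_context:
  assumes "(u, v) \<in> presented_rel S R" "p \<in> signed_words S" "q \<in> signed_words S"
  shows "(p @ u @ q, p @ v @ q) \<in> presented_rel S R"
  using assms
proof (induction rule: presented_rel.induct)
  case (refl w)
  then show ?case by (intro presented_rel.refl) (auto simp: signed_words_def)
next
  case (sym v w)
  then show ?case by (blast intro: presented_rel.sym)
next
  case (trans u v w)
  then show ?case by (blast intro: presented_rel.trans)
next
  case (cancel u v a b)
  then show ?case
    using presented_rel.cancel[of "p @ u" S "v @ q" a b R] by (auto simp: signed_words_def)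
next
  case (relator u v x y)
  then show ?case
    using presented_rel.relator[of "p @ u" S "v @ q" x y R] by (auto simp: signed_words_def)
qed

lemma presented_rel_append:
  assumes "(u, u') \<in> presented_rel S R" "(v, v') \<in> presented_rel S R"
  shows "(u @ v, u' @ v') \<in> presented_rel S R"
proof -
  have e: "[] \<in> signed_words S" by (simp add: signed_words_def)
  have "(u @ v, u' @ v) \<in> presented_rel S R"
    using presented_rel_context[OF assms(1) e, of v] presented_rel_words[OF assms(2)] by simp
  moreover have "(u' @ v, u' @ v') \<in> presented_rel S R"
    using presented_rel_context[OF assms(2) _ e, of u'] presented_rel_words[OF assms(1)] by simp
  ultimately show ?thesis by (rule presented_rel.trans)
qed

lemma presented_group_mult_class:
  assumes "u \<in> signed_words S" "v \<in> signed_words S"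
  shows "(presented_rel S R `` {u}) \<otimes>\<^bsub>presented_group S R\<^esub> (presented_rel S R `` {v})
    = presented_rel S R `` {u @ v}"
proof -
  note eq = equiv_presented_rel[of S R]
  have *: "presented_rel S R `` {u' @ v'} = presented_rel S R `` {u @ v}"
    if "(u, u') \<in> presented_rel S R" "(v, v') \<in> presented_rel S R" for u' v'
    using presented_rel_append[OF that] equiv_class_eq[OF eq] by metis
  have r: "(u, u) \<in> presented_rel S R" "(v, v) \<in> presented_rel S R"
    using assms by (auto intro: presented_rel.refl)
  have "(\<Union>u'\<in>presented_rel S R `` {u}. \<Union>v'\<in>presented_rel S R `` {v}. presented_rel S R `` {u' @ v'})
    = (\<Union>u'\<in>presented_rel S R `` {u}. \<Union>v'\<in>presented_rel S R `` {v}. presented_rel S R `` {u @ v})"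
    by (intro SUP_cong refl *) (simp_all only: Image_singleton_iff)
  also have "\<dots> = presented_rel S R `` {u @ v}"
    using r by blast
  finally show ?thesis by (simp only: presented_group_def monoid.simps)
qed

lemma signed_words_inverse:
  "w \<in> signed_words S \<Longrightarrow> rev (map (\<lambda>(a, b). (a, \<not> b)) w) \<in> signed_words S"
  by (induction w) (auto simp: signed_words_def)

lemma presented_rel_left_inverse:
  "w \<in> signed_words S \<Longrightarrow>
    (rev (map (\<lambda>(a, b). (a, \<not> b)) w) @ w, []) \<in> presented_rel S R"
proof (induction w)
  case Nil
  then show ?case by (auto intro: presented_rel.refl)
next
  case (Cons x w)
  obtain a b where x: "x = (a, b)" by (cases x)
  let ?w' = "rev (map (\<lambda>(a, b). (a, \<not> b)) w)"
  from Cons.prems x have "a \<in> S" and w: "w \<in> signed_words S"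
    by (auto simp: signed_words_def)
  moreover have "?w' \<in> signed_words S"
    using w by (rule signed_words_inverse)
  ultimately have "(?w' @ [(a, \<not> b), (a, b)] @ w, ?w' @ w) \<in> presented_rel S R"
    using presented_rel.cancel[of ?w' S w a "\<not> b" R] by simp
  with Cons.IH[OF w] show ?case by (auto simp: x intro: presented_rel.trans)
qed

lemma group_presented_group: "group (presented_group S R)"
proof (rule groupI)
  let ?G = "presented_group S R" and ?r = "presented_rel S R"
  have carr: "\<exists>u\<in>signed_words S. A = ?r `` {u}" if "A \<in> carrier ?G" for A
    using that by (auto simp: presented_group_def quotient_def)
  have cl: "?r `` {u} \<in> carrier ?G" if "u \<in> signed_words S" for u
    using that by (auto simp: presented_group_def intro: quotientI)
  have one: "\<one>\<^bsub>?G\<^esub> = ?r `` {[]}" by (simp add: presented_group_def)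
  have e: "[] \<in> signed_words S" by (simp add: signed_words_def)
  have app: "u @ v \<in> signed_words S" if "u \<in> signed_words S" "v \<in> signed_words S" for u v
    using that by (auto simp: signed_words_def)
  note m = presented_group_mult_class[of _ S _ R]
  show "x \<otimes>\<^bsub>?G\<^esub> y \<in> carrier ?G" if "x \<in> carrier ?G" "y \<in> carrier ?G" for x y
    using carr[OF that(1)] carr[OF that(2)] by (auto simp: m cl app)
  show "\<one>\<^bsub>?G\<^esub> \<in> carrier ?G" using cl[OF e] one by simp
  show "x \<otimes>\<^bsub>?G\<^esub> y \<otimes>\<^bsub>?G\<^esub> z = x \<otimes>\<^bsub>?G\<^esub> (y \<otimes>\<^bsub>?G\<^esub> z)"
    if "x \<in> carrier ?G" "y \<in> carrier ?G" "z \<in> carrier ?G" for x y z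
    using carr[OF that(1)] carr[OF that(2)] carr[OF that(3)] by (auto simp: m app)
  show "\<one>\<^bsub>?G\<^esub> \<otimes>\<^bsub>?G\<^esub> x = x" if "x \<in> carrier ?G" for x
    using carr[OF that] by (auto simp: m one e)
  show "\<exists>y\<in>carrier ?G. y \<otimes>\<^bsub>?G\<^esub> x = \<one>\<^bsub>?G\<^esub>" if x: "x \<in> carrier ?G" for x
  proof -
    obtain u where u: "u \<in> signed_words S" "x = ?r `` {u}" using carr[OF x] by blast
    let ?u' = "rev (map (\<lambda>(a, b). (a, \<not> b)) u)"
    have u': "?u' \<in> signed_words S" using u(1) by (rule signed_words_inverse)
    have "?r `` {?u' @ u} = ?r `` {[]}"
      using presented_rel_left_inverse[OF u(1)] equiv_class_eq[OF equiv_presented_rel] by metis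
    then have "(?r `` {?u'}) \<otimes>\<^bsub>?G\<^esub> x = \<one>\<^bsub>?G\<^esub>"
      using u u' by (simp only: m one)
    then show ?thesis using cl[OF u'] by blast
  qed
qed


section \<open>The complex reflection group \<open>G(d,1,n)\<close>\<close>

text \<open>The generator \<open>s\<^sub>i\<close> is encoded by its index \<open>i\<close>.\<close>

definition reflection_relations :: "nat \<Rightarrow> nat \<Rightarrow> (nat list \<times> nat list) set" where
  "reflection_relations d n =
     {(replicate d n, [])}
   \<union> {([i, i], []) | i. 1 \<le> i \<and> i < n}
   \<union> {([i, j], [j, i]) | i j. 1 \<le> j \<and> j + 1 < i \<and> i \<le> n}
   \<union> {([i + 1, i, i + 1], [i, i + 1, i]) | i. 1 \<le> i \<and> i + 1 < n}
   \<union> {([n, i, n, i], [i, n, i, n]) | i. 1 \<le> i \<and> i + 1 = n}"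

definition reflection_group :: "nat \<Rightarrow> nat \<Rightarrow> (nat \<times> bool) list set monoid" where
  "reflection_group d n = presented_group {1..n} (reflection_relations d n)"

definition word_elem :: "nat \<Rightarrow> nat \<Rightarrow> nat list \<Rightarrow> (nat \<times> bool) list set" where
  "word_elem d n w = presented_rel {1..n} (reflection_relations d n) `` {positive w}"

lemma word_elem_product:
  assumes "w \<in> lists {1..n}"
  shows "word_elem d n w =
    foldr (\<lambda>i g. word_elem d n [i] \<otimes>\<^bsub>reflection_group d n\<^esub> g) w \<one>\<^bsub>reflection_group d n\<^esub>"
  using assms
proof (induction w)
  case Nil
  then show ?case
    by (simp add: word_elem_def reflection_group_def presented_group_def positive_def)
next
  case (Cons i w)
  then have "positive [i] \<in> signed_words {1..n}" "positive w \<in> signed_words {1..n}"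
    by (auto simp: positive_def signed_words_def)
  from presented_group_mult_class[OF this, of "reflection_relations d n"] Cons show ?case
    by (auto simp: word_elem_def reflection_group_def positive_def)
qed

definition reduced_expressions :: "nat \<Rightarrow> nat \<Rightarrow> (nat \<times> bool) list set \<Rightarrow> nat list set" where
  "reduced_expressions d n g = {w \<in> lists {1..n}. word_elem d n w = g \<and>
     (\<forall>v\<in>lists {1..n}. word_elem d n v = g \<longrightarrow> length w \<le> length v)}"

text \<open>One application, in either direction, of a relation \<open>s\<^sub>i s\<^sub>j = s\<^sub>j s\<^sub>i\<close>.\<close>

definition commutation :: "nat \<Rightarrow> (nat list \<times> nat list) set" where
  "commutation n = {(u @ [i, j] @ v, u @ [j, i] @ v) | u v i j.
     i \<in> {1..n} \<and> j \<in> {1..n} \<and> (j + 1 < i \<or> i + 1 < j)}"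

definition fully_commutative :: "nat \<Rightarrow> nat \<Rightarrow> (nat \<times> bool) list set \<Rightarrow> bool" where
  "fully_commutative d n g \<longleftrightarrow>
     (\<forall>v\<in>reduced_expressions d n g. \<forall>w\<in>reduced_expressions d n g. (v, w) \<in> (commutation n)\<^sup>*)"


section \<open>Canonical words\<close>

text \<open>\<open>s\<^sub>i\<^sub>j = s\<^sub>i s\<^sub>i\<^sub>-\<^sub>1 \<dots> s\<^sub>j\<close>, which is empty for \<open>i < j\<close>.\<close>

definition descending :: "nat \<Rightarrow> nat \<Rightarrow> nat list" where
  "descending i j = rev [j..<i + 1]"

text \<open>\<open>s\<^sup>(\<^sup>k\<^sup>)\<^sub>n\<^sub>j = s\<^sub>n\<^sup>k s\<^sub>n\<^sub>-\<^sub>1\<^sub>,\<^sub>j\<close>; for \<open>j = n\<close> this is \<open>s\<^sub>n\<^sup>k\<close>.\<close>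

definition power_descending :: "nat \<Rightarrow> nat \<Rightarrow> nat \<Rightarrow> nat list" where
  "power_descending n k j = replicate k n @ descending (n - 1) j"

definition canonical_prefixes :: "nat \<Rightarrow> nat list set" where
  "canonical_prefixes n = {concat (map (\<lambda>p. descending p (i p)) [1..<n]) | i.
     \<forall>p\<in>{1..<n}. 1 \<le> i p \<and> i p \<le> p + 1}"

text \<open>The suffix \<open>s\<^sup>(\<^sup>k\<^sub>1\<^sup>)\<^sub>n\<^sub>j\<^sub>1 \<dots>\<close> is given by the list of pairs \<open>(k\<^sub>1, j\<^sub>1), (k\<^sub>2, j\<^sub>2), \<dots>\<close>.\<close>

definition suffix_data :: "nat \<Rightarrow> nat \<Rightarrow> (nat \<times> nat) list set" where
  "suffix_data d n = {xs. sorted_wrt (<) (map snd xs) \<and>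
     (\<forall>(k, j)\<in>set xs. 1 \<le> k \<and> k \<le> d - 1 \<and> 1 \<le> j \<and> j \<le> n)}"

definition suffix_word :: "nat \<Rightarrow> (nat \<times> nat) list \<Rightarrow> nat list" where
  "suffix_word n xs = concat (map (\<lambda>(k, j). power_descending n k j) xs)"

definition canonical_words :: "nat \<Rightarrow> nat \<Rightarrow> nat list set" where
  "canonical_words d n =
     {p @ suffix_word n xs | p xs. p \<in> canonical_prefixes n \<and> xs \<in> suffix_data d n}"


section \<open>Collections and packets\<close>

text \<open>A canonical prefix contains no letter \<open>s\<^sub>n\<close> and a nonempty canonical suffix starts with
  \<open>s\<^sub>n\<close>, so the suffix of a canonical word is determined by the word.\<close>

definition collection :: "nat \<Rightarrow> nat \<Rightarrow> nat list \<Rightarrow> nat list set" where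
  "collection d n s = {w \<in> canonical_words d n. (\<exists>p\<in>canonical_prefixes n. w = p @ s) \<and>
     fully_commutative d n (word_elem d n w)}"

definition packet_labels :: "nat \<Rightarrow> nat \<Rightarrow> nat \<Rightarrow> nat list set" where
  "packet_labels d n k =
    (if k = 0 then
       {suffix_word n xs | xs. xs \<in> suffix_data d n \<and> length xs \<ge> 2 \<and> snd (hd xs) = 1}
     else if k \<le> n - 2 then
       {power_descending n t k | t. 1 \<le> t \<and> t \<le> d - 1} \<union>
       {suffix_word n xs | xs. xs \<in> suffix_data d n \<and> length xs \<ge> 2 \<and> snd (hd xs) = k + 1}
     else if k = n - 1 then
       {replicate t n | t. 1 \<le> t \<and> t \<le> d - 1} \<union>
       {power_descending n t (n - 1) | t. 1 \<le> t \<and> t \<le> d - 1}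
     else if k = n then {[]}
     else {})"

definition packet :: "nat \<Rightarrow> nat \<Rightarrow> nat \<Rightarrow> nat list set set" where
  "packet d n k = collection d n ` packet_labels d n k"


section \<open>Catalan numbers, the Catalan triangle and its polynomials\<close>

definition catalan :: "nat \<Rightarrow> real" where
  "catalan n = real ((2 * n) choose n) / real (n + 1)"

definition catalan_triangle :: "nat \<Rightarrow> nat \<Rightarrow> real" where
  "catalan_triangle n k =
     fact (n + k) * (real n - real k + 1) / (fact k * fact (n + 1))"

definition catalan_triangle_poly :: "nat \<Rightarrow> nat \<Rightarrow> real poly" where
  "catalan_triangle_poly n k = (\<Sum>s = 0..k. monom (catalan_triangle n s) (k - s))"

end

theory Submission
  imports Defs
begin

text \<open>Fully commutative elements are counted through their canonical words, as follows.

  Any word can be normalised to a canonical word by moves that never lengthen it: commutations, the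
  short braid relations, the long relation in the form
  \<open>s\<^sub>n\<^sup>a s\<^sub>n\<^sub>-\<^sub>1 s\<^sub>n\<^sup>b s\<^sub>n\<^sub>-\<^sub>1 = s\<^sub>n\<^sub>-\<^sub>1 s\<^sub>n\<^sup>b s\<^sub>n\<^sub>-\<^sub>1 s\<^sub>n\<^sup>a\<close>, and deletions of \<open>s\<^sub>i s\<^sub>i\<close> and \<open>s\<^sub>n\<^sup>d\<close>
  (\<open>reduces_to_canonical\<close>). Distinct canonical words represent distinct elements, because they act
  differently on coloured positions (\<open>canonical_word_unique\<close>). Together these two facts replace a
  length function: canonical words are reduced, and every reduced expression is connected with its
  canonical word by commutations and braid moves alone. Hence an element is fully commutative if and
  only if no braid move can be applied to any word that is commutation equivalent to its canonical
  word (\<open>fully_commutative_iff_braid_free\<close>).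

  For a prefix this means that it is a product of descending runs \<open>s\<^sub>p \<dots> s\<^sub>q\<close> in which both \<open>p\<close>
  and \<open>q\<close> increase. This suffices in front of the empty suffix. In front of at least two
  blocks, all runs have to end below the end \<open>j\<close> of the first block. In front of one block with end \<open>j\<close>, the prefix may in addition finish with single letters \<open>s\<^sub>r, \<dots>, s\<^sub>n\<^sub>-\<^sub>1\<close>, where
  \<open>r \<ge> j\<close>. In every other case two equal letters can be brought together with only one neighbour
  between them, or a long braid move becomes possible (\<open>braid_free_imp_admissible\<close>). Conversely,
  the numbers of neighbours between consecutive equal letters are invariant under commutations, and
  in the admissible words they leave no room for a braid move (\<open>admissible_imp_braid_free\<close>).

  The admissible prefixes satisfy the recurrence of the Catalan triangle, so that every collection of
  the packet with index \<open>k\<close> has \<open>C(n, k)\<close> members. This is the first equation; the second one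
  follows by counting the suffixes of each packet.\<close>

section \<open>Words up to braid moves and shortenings\<close>

lemma descending_Nil: "i < j \<Longrightarrow> descending i j = []"
  by (simp add: descending_def)

lemma descending_Cons: "1 \<le> j \<Longrightarrow> j \<le> i \<Longrightarrow> descending i j = i # descending (i - 1) j"
  by (cases i) (auto simp: descending_def)

lemma descending_snoc: "j \<le> i \<Longrightarrow> descending i j = descending i (j + 1) @ [j]"
  by (simp add: descending_def upt_conv_Cons)

lemma descending_split:
  assumes "1 \<le> k" "j \<le> k" "k \<le> i + 1"
  shows "descending i j = descending i k @ descending (k - 1) j"
proof -
  have "[j..<i + 1] = [j..<k] @ [k..<i + 1]"
    using assms upt_add_eq_append[of j k "i + 1 - k"] by simp
  then show ?thesis using assms by (simp add: descending_def)
qed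

lemma set_descending [simp]: "set (descending i j) = {j..i}"
  by (auto simp: descending_def)

lemma commutation_sym: "(u, v) \<in> commutation n \<Longrightarrow> (v, u) \<in> commutation n"
  unfolding commutation_def by blast

lemma commutation_context:
  assumes "(u, v) \<in> commutation n"
  shows "(p @ u @ q, p @ v @ q) \<in> commutation n"
proof -
  obtain x y i j where "u = x @ [i, j] @ y" "v = x @ [j, i] @ y"
    "i \<in> {1..n} \<and> j \<in> {1..n} \<and> (j + 1 < i \<or> i + 1 < j)"
    using assms unfolding commutation_def by blast
  then have "p @ u @ q = (p @ x) @ [i, j] @ (y @ q) \<and> p @ v @ q = (p @ x) @ [j, i] @ (y @ q) \<and>
     i \<in> {1..n} \<and> j \<in> {1..n} \<and> (j + 1 < i \<or> i + 1 < j)"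
    by simp
  then show ?thesis unfolding commutation_def by blast
qed

text \<open>The braid relation of \<open>s\<^sub>n\<close> and \<open>s\<^sub>n\<^sub>-\<^sub>1\<close> says that \<open>s\<^sub>n\<close> commutes with
  \<open>s\<^sub>n\<^sub>-\<^sub>1 s\<^sub>n s\<^sub>n\<^sub>-\<^sub>1\<close>. For \<open>d > 2\<close> its consequence for powers, the long moves below, has to be
  added as a move of its own: with exponents \<open>a, b > 1\<close> it cannot be obtained from the relation by
  moves between words of the same length.\<close>

inductive braid_move :: "nat \<Rightarrow> nat list \<Rightarrow> nat list \<Rightarrow> bool" for n where
  short_up: "1 \<le> i \<Longrightarrow> i + 1 < n \<Longrightarrow>
    braid_move n (x @ [i, i + 1, i] @ z) (x @ [i + 1, i, i + 1] @ z)"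
| short_down: "1 \<le> i \<Longrightarrow> i + 1 < n \<Longrightarrow>
    braid_move n (x @ [i + 1, i, i + 1] @ z) (x @ [i, i + 1, i] @ z)"
| long_left: "1 \<le> a \<Longrightarrow> 1 \<le> b \<Longrightarrow> 2 \<le> n \<Longrightarrow>
    braid_move n (x @ replicate a n @ [n - 1] @ replicate b n @ [n - 1] @ z)
      (x @ [n - 1] @ replicate b n @ [n - 1] @ replicate a n @ z)"
| long_right: "1 \<le> a \<Longrightarrow> 1 \<le> b \<Longrightarrow> 2 \<le> n \<Longrightarrow>
    braid_move n (x @ [n - 1] @ replicate b n @ [n - 1] @ replicate a n @ z)
      (x @ replicate a n @ [n - 1] @ replicate b n @ [n - 1] @ z)"

inductive shortening :: "nat \<Rightarrow> nat \<Rightarrow> nat list \<Rightarrow> nat list \<Rightarrow> bool" for d n where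
  square: "1 \<le> i \<Longrightarrow> i < n \<Longrightarrow> shortening d n (x @ [i, i] @ z) (x @ z)"
| power: "shortening d n (x @ replicate d n @ z) (x @ z)"

lemma braid_move_sym: "braid_move n u v \<Longrightarrow> braid_move n v u"
  by (induction rule: braid_move.induct) (metis braid_move.intros)+

lemma braid_move_context: "braid_move n u v \<Longrightarrow> braid_move n (p @ u @ q) (p @ v @ q)"
proof (induction rule: braid_move.induct)
  case (short_up i x z)
  then show ?case using braid_move.short_up[of i n "p @ x" "z @ q"] by simp
next
  case (short_down i x z)
  then show ?case using braid_move.short_down[of i n "p @ x" "z @ q"] by simp
next
  case (long_left a b x z)
  then show ?case using braid_move.long_left[of a b n "p @ x" "z @ q"] by simp
next
  case (long_right a b x z)
  then show ?case using braid_move.long_right[of a b n "p @ x" "z @ q"] by simp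
qed

lemma shortening_context: "shortening d n u v \<Longrightarrow> shortening d n (p @ u @ q) (p @ v @ q)"
proof (induction rule: shortening.induct)
  case (square i x z)
  then show ?case using shortening.square[of i n d "p @ x" "z @ q"] by simp
next
  case (power x z)
  then show ?case using shortening.power[of d n "p @ x" "z @ q"] by simp
qed

lemma braid_move_length: "braid_move n u v \<Longrightarrow> length u = length v"
  by (induction rule: braid_move.induct) auto

lemma shortening_length: "shortening d n u v \<Longrightarrow> 1 \<le> d \<Longrightarrow> length v < length u"
  by (induction rule: shortening.induct) auto

lemma commutation_length: "(u, v) \<in> commutation n \<Longrightarrow> length u = length v"
  by (auto simp: commutation_def)

definition comm_equiv :: "nat \<Rightarrow> nat list \<Rightarrow> nat list \<Rightarrow> bool" where
  "comm_equiv n u v \<longleftrightarrow> (u, v) \<in> (commutation n)\<^sup>*"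

definition braid_equiv :: "nat \<Rightarrow> nat list \<Rightarrow> nat list \<Rightarrow> bool" where
  "braid_equiv n = (\<lambda>u v. (u, v) \<in> commutation n \<or> braid_move n u v)\<^sup>*\<^sup>*"

definition reduces :: "nat \<Rightarrow> nat \<Rightarrow> nat list \<Rightarrow> nat list \<Rightarrow> bool" where
  "reduces d n =
     (\<lambda>u v. (u, v) \<in> commutation n \<or> braid_move n u v \<or> shortening d n u v)\<^sup>*\<^sup>*"

lemma rtranclp_append:
  assumes ctxt: "\<And>u v p q. r u v \<Longrightarrow> r (p @ u @ q) (p @ v @ q)"
    and "r\<^sup>*\<^sup>* u u'" "r\<^sup>*\<^sup>* v v'"
  shows "r\<^sup>*\<^sup>* (u @ v) (u' @ v')"
proof -
  have "r\<^sup>*\<^sup>* (u @ v) (u' @ v)"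
    using assms(2)
  proof (induction rule: rtranclp_induct)
    case (step y z)
    then show ?case using ctxt[of y z "[]" v] by simp
  qed simp
  also have "r\<^sup>*\<^sup>* (u' @ v) (u' @ v')"
    using assms(3)
  proof (induction rule: rtranclp_induct)
    case (step y z)
    then show ?case using ctxt[of y z u' "[]"] by simp
  qed simp
  finally show ?thesis .
qed

lemma comm_equiv_refl [simp, intro]: "comm_equiv n u u"
  by (simp add: comm_equiv_def)

lemma comm_equiv_trans [trans]: "comm_equiv n u v \<Longrightarrow> comm_equiv n v w \<Longrightarrow> comm_equiv n u w"
  by (auto simp: comm_equiv_def)

lemma comm_equiv_sym: "comm_equiv n u v \<Longrightarrow> comm_equiv n v u"
  unfolding comm_equiv_def
  by (metis commutation_sym sym_rtrancl symD symI)

lemma comm_equiv_append: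
  assumes "comm_equiv n u u'" "comm_equiv n v v'"
  shows "comm_equiv n (u @ v) (u' @ v')"
  using rtranclp_append[of "\<lambda>u v. (u, v) \<in> commutation n" u u' v v'] assms commutation_context
  by (simp add: comm_equiv_def rtranclp_rtrancl_eq)

lemma braid_equiv_refl [simp, intro]: "braid_equiv n u u"
  by (simp add: braid_equiv_def)

lemma braid_equiv_trans [trans]: "braid_equiv n u v \<Longrightarrow> braid_equiv n v w \<Longrightarrow> braid_equiv n u w"
  by (auto simp: braid_equiv_def)

lemma braid_equiv_sym: "braid_equiv n u v \<Longrightarrow> braid_equiv n v u"
  unfolding braid_equiv_def
  by (rule sympD[OF symp_rtranclp]) (auto intro!: sympI dest: commutation_sym braid_move_sym)

lemma braid_equiv_append:
  assumes "braid_equiv n u u'" "braid_equiv n v v'"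
  shows "braid_equiv n (u @ v) (u' @ v')"
  using assms unfolding braid_equiv_def
  by (intro rtranclp_append) (auto intro: commutation_context braid_move_context)

lemma reduces_refl [simp, intro]: "reduces d n u u"
  by (simp add: reduces_def)

lemma reduces_trans [trans]: "reduces d n u v \<Longrightarrow> reduces d n v w \<Longrightarrow> reduces d n u w"
  by (auto simp: reduces_def)

lemma reduces_append:
  assumes "reduces d n u u'" "reduces d n v v'"
  shows "reduces d n (u @ v) (u' @ v')"
  using assms unfolding reduces_def
  by (intro rtranclp_append) (auto intro: commutation_context braid_move_context shortening_context)

lemma comm_equiv_imp_braid_equiv: "comm_equiv n u v \<Longrightarrow> braid_equiv n u v"
  unfolding comm_equiv_def braid_equiv_def
  by (induction rule: rtrancl_induct) (auto intro: rtranclp.rtrancl_into_rtrancl)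

lemma braid_equiv_imp_reduces: "braid_equiv n u v \<Longrightarrow> reduces d n u v"
  unfolding braid_equiv_def reduces_def
  by (induction rule: rtranclp_induct) (auto intro: rtranclp.rtrancl_into_rtrancl)

lemma comm_equiv_letter:
  assumes "i \<in> {1..n}" "\<And>a. a \<in> set w \<Longrightarrow> a \<in> {1..n} \<and> (a + 1 < i \<or> i + 1 < a)"
  shows "comm_equiv n (w @ [i]) ([i] @ w)"
  using assms(2)
proof (induction w)
  case (Cons a w)
  have "([] @ [a, i] @ w, [] @ [i, a] @ w) \<in> commutation n"
    using assms(1) Cons.prems[of a] unfolding commutation_def by fastforce
  then have *: "comm_equiv n ([a] @ [i] @ w) ([i] @ [a] @ w)"
    by (auto simp: comm_equiv_def)
  have "comm_equiv n ([a] @ (w @ [i])) ([a] @ ([i] @ w))"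
    by (rule comm_equiv_append) (use Cons in auto)
  with * show ?case by (auto intro: comm_equiv_trans)
qed simp

lemma comm_equiv_words:
  assumes "\<And>a b. a \<in> set u \<Longrightarrow> b \<in> set w \<Longrightarrow>
    a \<in> {1..n} \<and> b \<in> {1..n} \<and> (a + 1 < b \<or> b + 1 < a)"
  shows "comm_equiv n (u @ w) (w @ u)"
  using assms
proof (induction w)
  case (Cons b w)
  show ?case
  proof (cases "u = []")
    case False
    then have b: "b \<in> {1..n}" using Cons.prems by (meson hd_in_set list.set_intros(1))
    have "comm_equiv n (u @ [b]) ([b] @ u)"
      using Cons.prems b by (intro comm_equiv_letter) auto
    then have "comm_equiv n ((u @ [b]) @ w) (([b] @ u) @ w)"
      by (rule comm_equiv_append) simp
    also have "([b] @ u) @ w = [b] @ (u @ w)" by simp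
    also have "comm_equiv n \<dots> ([b] @ (w @ u))"
      by (rule comm_equiv_append) (use Cons in auto)
    finally show ?thesis by simp
  qed simp
qed simp

lemma braid_equiv_context: "braid_equiv n u v \<Longrightarrow> braid_equiv n (x @ u @ z) (x @ v @ z)"
  by (intro braid_equiv_append) auto

lemma comm_equiv_context: "comm_equiv n u v \<Longrightarrow> comm_equiv n (x @ u @ z) (x @ v @ z)"
  by (intro comm_equiv_append) auto

lemma reduces_context: "reduces d n u v \<Longrightarrow> reduces d n (x @ u @ z) (x @ v @ z)"
  by (intro reduces_append) auto


section \<open>Every word reduces to a canonical word\<close>

text \<open>Multiplication from the right by an inner letter of a descending run is multiplication from the
  left by the next lower letter: after commutations this is one short braid move.\<close>

lemma descending_slide:
  assumes "1 \<le> j" "j < i" "i \<le> m" "m < n"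
  shows "braid_equiv n (descending m j @ [i]) ([i - 1] @ descending m j)"
proof -
  let ?h = "descending m (i + 1)" and ?t = "descending (i - 2) j"
  have eq: "descending m j = ?h @ [i, i - 1] @ ?t"
    using assms descending_split[of "i + 1" j m] descending_Cons[of j i] descending_Cons[of j "i - 1"]
    by (simp add: numeral_2_eq_2)
  have "braid_equiv n (?t @ [i]) ([i] @ ?t)"
    using assms by (intro comm_equiv_imp_braid_equiv comm_equiv_letter) auto
  then have "braid_equiv n ((?h @ [i, i - 1]) @ (?t @ [i]) @ []) ((?h @ [i, i - 1]) @ ([i] @ ?t) @ [])"
    by (rule braid_equiv_context)
  also have "braid_equiv n (?h @ [i, i - 1, i] @ ?t) (?h @ [i - 1, i, i - 1] @ ?t)"
    unfolding braid_equiv_def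
    using assms braid_move.short_down[of "i - 1" n ?h ?t] by (intro r_into_rtranclp disjI2) simp
  then have "braid_equiv n ((?h @ [i, i - 1]) @ ([i] @ ?t) @ []) ((?h @ [i - 1]) @ [i, i - 1] @ ?t)"
    by simp
  also have "braid_equiv n (?h @ [i - 1]) ([i - 1] @ ?h)"
    using assms by (intro comm_equiv_imp_braid_equiv comm_equiv_letter) auto
  then have "braid_equiv n ((?h @ [i - 1]) @ [i, i - 1] @ ?t) (([i - 1] @ ?h) @ [i, i - 1] @ ?t)"
    by (rule braid_equiv_append) simp
  finally show ?thesis by (simp add: eq)
qed

lemma descending_slide_descending:
  assumes "1 \<le> j" "m < n" "j < k" "k \<le> m + 1"
  shows "braid_equiv n (descending m j @ descending m k) (descending (m - 1) (k - 1) @ descending m j)"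
  using assms(4,3)
proof (induction rule: inc_induct)
  case base
  show ?case using assms by (simp add: descending_Nil)
next
  case (step k)
  have "braid_equiv n ((descending m j @ descending m (Suc k)) @ [k])
     ((descending (m - 1) k @ descending m j) @ [k])"
    by (rule braid_equiv_append) (use step in auto)
  also have "braid_equiv n (descending (m - 1) k @ (descending m j @ [k]))
      (descending (m - 1) k @ ([k - 1] @ descending m j))"
    using step assms by (intro braid_equiv_append descending_slide) auto
  then have "braid_equiv n ((descending (m - 1) k @ descending m j) @ [k])
      (descending (m - 1) (k - 1) @ descending m j)"
    using step assms descending_snoc[of "k - 1" "m - 1"] by simp
  finally show ?case
    using step descending_snoc[of k m] by simp
qed

lemma power_descending_slide:
  assumes "1 \<le> j" "j < i" "i < n"
  shows "braid_equiv n (power_descending n k j @ [i]) ([i - 1] @ power_descending n k j)"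
proof -
  have "braid_equiv n (replicate k n @ (descending (n - 1) j @ [i]))
     (replicate k n @ ([i - 1] @ descending (n - 1) j))"
    using assms by (intro braid_equiv_append descending_slide) auto
  also have "braid_equiv n ((replicate k n @ [i - 1]) @ descending (n - 1) j)
      (([i - 1] @ replicate k n) @ descending (n - 1) j)"
    using assms by (intro braid_equiv_append comm_equiv_imp_braid_equiv comm_equiv_letter) auto
  then have "braid_equiv n (replicate k n @ ([i - 1] @ descending (n - 1) j))
      (([i - 1] @ replicate k n) @ descending (n - 1) j)"
    by simp
  finally show ?thesis by (simp add: power_descending_def)
qed

text \<open>The only place where the long braid moves enter the normalisation: two adjacent blocks with the
  same end are put into increasing order.\<close>

lemma power_descending_swap:
  assumes "1 \<le> j" "j < n" "1 \<le> a" "1 \<le> b"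
  shows "braid_equiv n (power_descending n a j @ power_descending n b j)
    ([n - 1] @ power_descending n b j @ power_descending n a (j + 1))"
proof -
  let ?A = "replicate a n" and ?B = "replicate b n"
  let ?D = "descending (n - 1) j" and ?E = "descending (n - 2) j" and ?D' = "descending (n - 1) (j + 1)"
  have n2: "n - 1 - 1 = n - 2" by simp
  have D: "?D = [n - 1] @ ?E"
    using assms descending_Cons[of j "n - 1"] n2 by simp
  have "braid_equiv n (?E @ ?B) (?B @ ?E)"
    using assms by (intro comm_equiv_imp_braid_equiv comm_equiv_words) auto
  then have "braid_equiv n ((?A @ [n - 1]) @ (?E @ ?B) @ ?D) ((?A @ [n - 1]) @ (?B @ ?E) @ ?D)"
    by (rule braid_equiv_context)
  also have "braid_equiv n (?E @ ?D) (?D @ ?D')"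
    using assms descending_slide_descending[of j "n - 1" n "j + 1"] n2
    by (intro braid_equiv_sym[of n "?D @ ?D'"]) simp
  then have "braid_equiv n ((?A @ [n - 1] @ ?B) @ (?E @ ?D)) ((?A @ [n - 1] @ ?B) @ (?D @ ?D'))"
    by (rule braid_equiv_append[OF braid_equiv_refl])
  then have "braid_equiv n ((?A @ [n - 1]) @ (?B @ ?E) @ ?D)
      ([] @ (?A @ [n - 1] @ ?B @ [n - 1]) @ ?E @ ?D')"
    unfolding D by simp
  also have "braid_equiv n ([] @ (?A @ [n - 1] @ ?B @ [n - 1]) @ ?E @ ?D')
      ([n - 1] @ ?B @ [n - 1] @ (?A @ ?E) @ ?D')"
    using assms braid_move.long_left[of a b n "[]" "?E @ ?D'"] by (auto simp: braid_equiv_def)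
  also have "braid_equiv n (?A @ ?E) (?E @ ?A)"
    using assms by (intro comm_equiv_imp_braid_equiv comm_equiv_words) auto
  then have "braid_equiv n (([n - 1] @ ?B @ [n - 1]) @ (?A @ ?E) @ ?D')
      (([n - 1] @ ?B @ [n - 1]) @ (?E @ ?A) @ ?D')"
    by (rule braid_equiv_context)
  then have "braid_equiv n ([n - 1] @ ?B @ [n - 1] @ (?A @ ?E) @ ?D')
      (([n - 1] @ ?B @ [n - 1]) @ (?E @ ?A) @ ?D')"
    by simp
  finally show ?thesis unfolding power_descending_def D by simp
qed

lemma canonical_prefixes_1: "canonical_prefixes (Suc 0) = {[]}"
  by (auto simp: canonical_prefixes_def)

lemma canonical_prefixes_Suc:
  assumes "1 \<le> m"
  shows "canonical_prefixes (Suc m) =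
    {u @ descending m q | u q. u \<in> canonical_prefixes m \<and> 1 \<le> q \<and> q \<le> m + 1}" (is "?L = ?R")
proof
  show "?L \<subseteq> ?R"
    using assms by (fastforce simp: canonical_prefixes_def)
  show "?R \<subseteq> ?L"
  proof
    fix w assume "w \<in> ?R"
    then obtain i q where w: "w = concat (map (\<lambda>p. descending p (i p)) [1..<m]) @ descending m q"
      and i: "\<forall>p\<in>{1..<m}. 1 \<le> i p \<and> i p \<le> p + 1" and q: "1 \<le> q" "q \<le> m + 1"
      by (auto simp: canonical_prefixes_def)
    have "map (\<lambda>p. descending p ((i(m := q)) p)) [1..<m] = map (\<lambda>p. descending p (i p)) [1..<m]"
      by (intro map_cong) auto
    moreover have "concat (map (\<lambda>p. descending p ((i(m := q)) p)) [1..<Suc m]) =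
        concat (map (\<lambda>p. descending p ((i(m := q)) p)) [1..<m]) @ descending m ((i(m := q)) m)"
      using assms by (simp del: fun_upd_apply)
    ultimately have "w = concat (map (\<lambda>p. descending p ((i(m := q)) p)) [1..<Suc m])"
      by (simp only: w fun_upd_same)
    moreover have "\<forall>p\<in>{1..<Suc m}. 1 \<le> (i(m := q)) p \<and> (i(m := q)) p \<le> p + 1"
      using i q by auto
    ultimately show "w \<in> ?L" unfolding canonical_prefixes_def by blast
  qed
qed

lemma canonical_prefix_letters: "p \<in> canonical_prefixes n \<Longrightarrow> set p \<subseteq> {1..<n}"
  by (fastforce simp: canonical_prefixes_def)

lemma Nil_in_canonical_prefixes: "1 \<le> m \<Longrightarrow> [] \<in> canonical_prefixes m"
proof (induction m rule: dec_induct)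
  case (step m)
  then show ?case using descending_Nil[of m "m + 1"] by (fastforce simp: canonical_prefixes_Suc)
qed (simp add: canonical_prefixes_1)

text \<open>The four cases are those of multiplying a run \<open>s\<^sub>m \<dots> s\<^sub>q\<close> by \<open>s\<^sub>i\<close>: the letter commutes with
  the run, prolongs it, cancels its end, or slides through it.\<close>

lemma canonical_prefix_times_letter:
  assumes "1 \<le> m" "m \<le> n" "w \<in> canonical_prefixes m" "1 \<le> i" "i < m"
  shows "\<exists>w'\<in>canonical_prefixes m. reduces d n (w @ [i]) w'"
  using assms
proof (induction m arbitrary: w i rule: dec_induct)
  case (step m)
  obtain u q where w: "w = u @ descending m q" and u: "u \<in> canonical_prefixes m"
    and q: "1 \<le> q" "q \<le> m + 1"
    using step by (auto simp: canonical_prefixes_Suc)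
  consider "i + 1 < q" | "i + 1 = q" | "i = q" | "q < i" by linarith
  then show ?case
  proof cases
    case 1
    have "reduces d n (descending m q @ [i]) ([i] @ descending m q)"
      using 1 q step by (intro braid_equiv_imp_reduces comm_equiv_imp_braid_equiv comm_equiv_letter) auto
    then have *: "reduces d n (w @ [i]) ((u @ [i]) @ descending m q)"
      using reduces_context[of d n _ _ u "[]"] w by simp
    have "\<exists>u'\<in>canonical_prefixes m. reduces d n (u @ [i]) u'"
      by (rule step.IH) (use step.prems 1 q u in auto)
    then obtain u' where "u' \<in> canonical_prefixes m" "reduces d n (u @ [i]) u'" ..
    then have "u' @ descending m q \<in> canonical_prefixes (Suc m)"
      "reduces d n (w @ [i]) (u' @ descending m q)"
      using q step.hyps reduces_trans[OF * reduces_append[OF _ reduces_refl]]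
      by (auto simp: canonical_prefixes_Suc)
    then show ?thesis by blast
  next
    case 2
    then have "w @ [i] = u @ descending m i"
      using w descending_snoc[of i m] q by simp
    moreover have "\<dots> \<in> canonical_prefixes (Suc m)"
      using u 2 step unfolding canonical_prefixes_Suc[OF step.hyps(1)] by fastforce
    ultimately show ?thesis by fastforce
  next
    case 3
    have "reduces d n ((u @ descending m (q + 1)) @ [i, i] @ []) ((u @ descending m (q + 1)) @ [])"
      unfolding reduces_def using step.prems
      by (intro r_into_rtranclp disjI2 shortening.square) auto
    then have "reduces d n (w @ [i]) (u @ descending m (q + 1))"
      using w descending_snoc[of q m] 3 step by simp
    moreover have "u @ descending m (q + 1) \<in> canonical_prefixes (Suc m)"
      using u 3 q step by (force simp: canonical_prefixes_Suc)
    ultimately show ?thesis by blast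
  next
    case 4
    have "reduces d n (descending m q @ [i]) ([i - 1] @ descending m q)"
      using 4 q step by (intro braid_equiv_imp_reduces descending_slide) auto
    then have *: "reduces d n (w @ [i]) ((u @ [i - 1]) @ descending m q)"
      using reduces_context[of d n _ _ u "[]"] w by simp
    have "\<exists>u'\<in>canonical_prefixes m. reduces d n (u @ [i - 1]) u'"
      by (rule step.IH) (use step.prems 4 q u in auto)
    then obtain u' where "u' \<in> canonical_prefixes m" "reduces d n (u @ [i - 1]) u'" ..
    then have "u' @ descending m q \<in> canonical_prefixes (Suc m)"
      "reduces d n (w @ [i]) (u' @ descending m q)"
      using q step.hyps reduces_trans[OF * reduces_append[OF _ reduces_refl]]
      by (auto simp: canonical_prefixes_Suc)
    then show ?thesis by blast
  qed
qed simp

lemma suffix_data_snoc: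
  "xs @ [(k, j)] \<in> suffix_data d n \<longleftrightarrow> xs \<in> suffix_data d n \<and> (\<forall>j'\<in>snd ` set xs. j' < j) \<and>
     1 \<le> k \<and> k \<le> d - 1 \<and> 1 \<le> j \<and> j \<le> n"
  by (auto simp: suffix_data_def sorted_wrt_append)

lemma suffix_data_Cons:
  "(k, j) # xs \<in> suffix_data d n \<longleftrightarrow> xs \<in> suffix_data d n \<and> (\<forall>j'\<in>snd ` set xs. j < j') \<and>
     1 \<le> k \<and> k \<le> d - 1 \<and> 1 \<le> j \<and> j \<le> n"
  by (auto simp: suffix_data_def)

lemma suffix_data_Nil [simp]: "[] \<in> suffix_data d n"
  by (simp add: suffix_data_def)

lemma suffix_word_simps [simp]:
  "suffix_word n [] = []"
  "suffix_word n ((k, j) # xs) = power_descending n k j @ suffix_word n xs"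
  "suffix_word n (xs @ ys) = suffix_word n xs @ suffix_word n ys"
  by (simp_all add: suffix_word_def)

text \<open>A letter whose index exceeds the ends of all blocks moves through the whole suffix and loses one
  from its index at each block; the ends are at least \<open>1, 2, \<dots>\<close>, so the index stays positive.\<close>

lemma suffix_slide:
  assumes "xs \<in> suffix_data d n" "\<forall>j\<in>snd ` set xs. j < i" "1 \<le> i" "i < n"
  shows "\<exists>i'. 1 \<le> i' \<and> i' < n \<and> reduces d n (suffix_word n xs @ [i]) ([i'] @ suffix_word n xs)"
  using assms
proof (induction xs arbitrary: i rule: rev_induct)
  case (snoc x xs)
  obtain k j where x: "x = (k, j)" by (cases x)
  have xs: "xs \<in> suffix_data d n" "\<forall>j'\<in>snd ` set xs. j' < j" and j: "1 \<le> j" "j < i"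
    using snoc.prems by (auto simp: x suffix_data_snoc)
  then obtain i' where i': "1 \<le> i'" "i' < n"
    "reduces d n (suffix_word n xs @ [i - 1]) ([i'] @ suffix_word n xs)"
    using snoc.IH[of "i - 1"] snoc.prems by fastforce
  have "reduces d n (suffix_word n xs @ (power_descending n k j @ [i]))
      (suffix_word n xs @ ([i - 1] @ power_descending n k j))"
    using j snoc.prems by (intro reduces_append braid_equiv_imp_reduces power_descending_slide) auto
  also have "reduces d n ((suffix_word n xs @ [i - 1]) @ power_descending n k j)
      (([i'] @ suffix_word n xs) @ power_descending n k j)"
    by (rule reduces_append[OF i'(3) reduces_refl])
  then have "reduces d n (suffix_word n xs @ ([i - 1] @ power_descending n k j))
      (([i'] @ suffix_word n xs) @ power_descending n k j)"
    by simp
  finally show ?case using i' by (auto simp: x)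
qed auto

text \<open>A letter \<open>s\<^sub>i\<close> with \<open>i < n\<close> meets the last block \<open>s\<^sub>n\<^sup>k s\<^sub>n\<^sub>-\<^sub>1 \<dots> s\<^sub>j\<close> as it would meet a
  run, with one difference: if it prolongs the block to the end \<open>j - 1\<close> of the preceding block, the
  two blocks have to be swapped. If it commutes with the last block, it acts on the shorter suffix,
  and the bound on the ends of the new blocks keeps the blocks sorted when the last block is put
  back.\<close>

lemma canonical_times_letter:
  assumes "xs \<in> suffix_data d n" "p \<in> canonical_prefixes n" "1 \<le> i" "i < n"
  shows "\<exists>p' xs'. p' \<in> canonical_prefixes n \<and> xs' \<in> suffix_data d n \<and>
      reduces d n (p @ suffix_word n xs @ [i]) (p' @ suffix_word n xs') \<and>
      (\<forall>J. (\<forall>j\<in>snd ` set xs. j < J) \<longrightarrow> i + 1 < J \<longrightarrow> (\<forall>j\<in>snd ` set xs'. j < J))"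
  using assms
proof (induction xs arbitrary: p i rule: rev_induct)
  case Nil
  then show ?case
    using canonical_prefix_times_letter[of n n p i d] by fastforce
next
  case (snoc x ys)
  obtain k j where x: "x = (k, j)" by (cases x)
  have ys: "ys \<in> suffix_data d n" "\<forall>j'\<in>snd ` set ys. j' < j"
    and j: "1 \<le> j" "j \<le> n" and k: "1 \<le> k" "k \<le> d - 1"
    using snoc.prems by (auto simp: x suffix_data_snoc)
  consider "j < i" | "i = j" | "i + 1 = j" "\<forall>j'\<in>snd ` set ys. j' < i"
    | "i + 1 = j" "\<not> (\<forall>j'\<in>snd ` set ys. j' < i)" | "i + 1 < j" by linarith
  then show ?case
  proof cases
    case 1
    then have lt: "\<forall>j\<in>snd ` set (ys @ [x]). j < i" using ys by (auto simp: x)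
    obtain i' where i': "1 \<le> i'" "i' < n"
      "reduces d n (suffix_word n (ys @ [x]) @ [i]) ([i'] @ suffix_word n (ys @ [x]))"
      using suffix_slide[OF snoc.prems(1) lt snoc.prems(3,4)] by blast
    obtain p' where p': "p' \<in> canonical_prefixes n" "reduces d n (p @ [i']) p'"
      using canonical_prefix_times_letter[of n n p i' d] snoc.prems i' by auto
    have "reduces d n (p @ (suffix_word n (ys @ [x]) @ [i])) (p @ ([i'] @ suffix_word n (ys @ [x])))"
      by (rule reduces_append[OF reduces_refl i'(3)])
    also have "reduces d n ((p @ [i']) @ suffix_word n (ys @ [x])) (p' @ suffix_word n (ys @ [x]))"
      by (rule reduces_append[OF p'(2) reduces_refl])
    then have "reduces d n (p @ ([i'] @ suffix_word n (ys @ [x]))) (p' @ suffix_word n (ys @ [x]))"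
      by simp
    finally show ?thesis using p' snoc.prems(1) by blast
  next
    case 2
    have "reduces d n
       ((p @ suffix_word n ys @ replicate k n @ descending (n - 1) (j + 1)) @ [i, i] @ [])
       ((p @ suffix_word n ys @ replicate k n @ descending (n - 1) (j + 1)) @ [])"
      unfolding reduces_def using snoc.prems
      by (intro r_into_rtranclp disjI2 shortening.square) auto
    then have "reduces d n (p @ suffix_word n (ys @ [x]) @ [i]) (p @ suffix_word n (ys @ [(k, j + 1)]))"
      using 2 descending_snoc[of j "n - 1"] snoc.prems by (simp add: x power_descending_def)
    moreover have "ys @ [(k, j + 1)] \<in> suffix_data d n"
      using ys j k 2 snoc.prems by (auto simp: suffix_data_snoc)
    ultimately show ?thesis using 2 snoc.prems(2)
      by (intro exI[of _ p] exI[of _ "ys @ [(k, j + 1)]"]) auto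
  next
    case 3
    have "p @ suffix_word n (ys @ [x]) @ [i] = p @ suffix_word n (ys @ [(k, i)])"
      using 3 descending_snoc[of i "n - 1"] snoc.prems by (simp add: x power_descending_def)
    moreover have "ys @ [(k, i)] \<in> suffix_data d n"
      using ys j k 3 snoc.prems by (auto simp: suffix_data_snoc)
    ultimately show ?thesis using 3 snoc.prems(2)
      by (intro exI[of _ p] exI[of _ "ys @ [(k, i)]"]) auto
  next
    case 4
    obtain zs y where y: "ys = zs @ [y]" using 4 by (cases ys rule: rev_cases) auto
    obtain a b where ab: "y = (a, b)" by (cases y)
    have zs: "zs \<in> suffix_data d n" "\<forall>j'\<in>snd ` set zs. j' < b" and b: "1 \<le> b" "b \<le> n" "1 \<le> a" "a \<le> d - 1"
      using ys by (auto simp: y ab suffix_data_snoc)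
    \<comment> \<open>The end of the previous block is the largest of the remaining ends, hence equals \<open>i\<close>.\<close>
    have bi: "b = i" using 4 ys zs by (force simp: y ab)
    have lt: "\<forall>j'\<in>snd ` set zs. j' < n - 1" using zs bi snoc.prems by force
    obtain i' where i': "1 \<le> i'" "i' < n"
      "reduces d n (suffix_word n zs @ [n - 1]) ([i'] @ suffix_word n zs)"
      using suffix_slide[OF zs(1) lt] snoc.prems by fastforce
    obtain p' where p': "p' \<in> canonical_prefixes n" "reduces d n (p @ [i']) p'"
      using canonical_prefix_times_letter[of n n p i' d] snoc.prems i' by auto
    let ?B = "power_descending n k i" and ?A = "power_descending n a (i + 1)"
    have eq: "p @ suffix_word n (ys @ [x]) @ [i] =
        (p @ suffix_word n zs) @ (power_descending n a i @ power_descending n k i)"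
      using 4 bi descending_snoc[of i "n - 1"] snoc.prems by (simp add: x y ab power_descending_def)
    have "reduces d n ((p @ suffix_word n zs) @ (power_descending n a i @ power_descending n k i))
        ((p @ suffix_word n zs) @ ([n - 1] @ ?B @ ?A))"
      using snoc.prems b k by (intro reduces_append braid_equiv_imp_reduces power_descending_swap) auto
    also have "reduces d n (p @ (suffix_word n zs @ [n - 1]) @ ?B @ ?A)
        (p @ ([i'] @ suffix_word n zs) @ ?B @ ?A)"
      by (rule reduces_context[OF i'(3)])
    then have "reduces d n ((p @ suffix_word n zs) @ ([n - 1] @ ?B @ ?A))
        (p @ ([i'] @ suffix_word n zs) @ ?B @ ?A)"
      by simp
    also have "reduces d n ((p @ [i']) @ suffix_word n zs @ ?B @ ?A) (p' @ suffix_word n zs @ ?B @ ?A)"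
      by (rule reduces_append[OF p'(2) reduces_refl])
    then have "reduces d n (p @ ([i'] @ suffix_word n zs) @ ?B @ ?A) (p' @ suffix_word n zs @ ?B @ ?A)"
      by simp
    finally have "reduces d n (p @ suffix_word n (ys @ [x]) @ [i])
        (p' @ suffix_word n (zs @ [(k, i), (a, i + 1)]))"
      unfolding eq by simp
    moreover have "(zs @ [(k, i)]) @ [(a, i + 1)] \<in> suffix_data d n"
      unfolding suffix_data_snoc using zs b k bi snoc.prems by force
    then have "zs @ [(k, i), (a, i + 1)] \<in> suffix_data d n" by simp
    ultimately show ?thesis using 4 p' bi
      by (intro exI[of _ p'] exI[of _ "zs @ [(k, i), (a, i + 1)]"]) (auto simp: y ab x)
  next
    case 5
    obtain p' ys' where IH: "p' \<in> canonical_prefixes n" "ys' \<in> suffix_data d n"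
      "reduces d n (p @ suffix_word n ys @ [i]) (p' @ suffix_word n ys')"
      "\<And>J. (\<forall>j\<in>snd ` set ys. j < J) \<Longrightarrow> i + 1 < J \<Longrightarrow> (\<forall>j\<in>snd ` set ys'. j < J)"
      using snoc.IH[OF ys(1) snoc.prems(2-4)] by blast
    have "reduces d n (power_descending n k j @ [i]) ([i] @ power_descending n k j)"
      using 5 snoc.prems j
      by (intro braid_equiv_imp_reduces comm_equiv_imp_braid_equiv comm_equiv_letter)
        (auto simp: power_descending_def)
    then have "reduces d n ((p @ suffix_word n ys) @ (power_descending n k j @ [i]))
        ((p @ suffix_word n ys) @ ([i] @ power_descending n k j))"
      by (rule reduces_append[OF reduces_refl])
    also have "reduces d n ((p @ suffix_word n ys @ [i]) @ power_descending n k j)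
        ((p' @ suffix_word n ys') @ power_descending n k j)"
      by (rule reduces_append[OF IH(3) reduces_refl])
    then have "reduces d n ((p @ suffix_word n ys) @ ([i] @ power_descending n k j))
        (p' @ suffix_word n (ys' @ [(k, j)]))"
      by simp
    finally have "reduces d n (p @ suffix_word n (ys @ [x]) @ [i]) (p' @ suffix_word n (ys' @ [(k, j)]))"
      by (simp add: x)
    moreover have "ys' @ [(k, j)] \<in> suffix_data d n"
      unfolding suffix_data_snoc using IH(2) IH(4)[OF ys(2) 5] j k by blast
    ultimately show ?thesis using IH(1,4)
      by (intro exI[of _ p'] exI[of _ "ys' @ [(k, j)]"]) (auto simp: x)
  qed
qed

lemma canonical_times_last_letter:
  assumes "1 \<le> d" "1 \<le> n" "xs \<in> suffix_data d n" 
  shows "\<exists>xs'\<in>suffix_data d n. reduces d n (suffix_word n xs @ [n]) (suffix_word n xs')"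
proof (cases "d = 1")
  case True
  have "reduces d n (suffix_word n xs @ replicate d n @ []) (suffix_word n xs @ [])"
    unfolding reduces_def by (intro r_into_rtranclp disjI2 shortening.power)
  then show ?thesis using True assms by auto
next
  case False
  show ?thesis
  proof (cases "\<forall>j\<in>snd ` set xs. j < n")
    case True
    then have "xs @ [(1, n)] \<in> suffix_data d n"
      using assms False by (auto simp: suffix_data_snoc)
    moreover have "suffix_word n xs @ [n] = suffix_word n (xs @ [(1, n)])"
      using assms by (simp add: power_descending_def descending_Nil)
    ultimately show ?thesis by (metis reduces_refl)
  next
    case n: False
    obtain ys k j where xs: "xs = ys @ [(k, j)]" using n by (cases xs rule: rev_cases) auto
    have ys: "ys \<in> suffix_data d n" "\<forall>j'\<in>snd ` set ys. j' < j" "j \<le> n" "1 \<le> k" "k \<le> d - 1"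
      using assms by (auto simp: xs suffix_data_snoc)
    then have j: "j = n" using n by (fastforce simp: xs)
    have eq: "suffix_word n xs @ [n] = suffix_word n ys @ replicate (k + 1) n @ []"
      using assms by (simp add: xs j power_descending_def descending_Nil replicate_append_same)
    show ?thesis
    proof (cases "k + 1 = d")
      case True
      have "reduces d n (suffix_word n ys @ replicate d n @ []) (suffix_word n ys @ [])"
        unfolding reduces_def by (intro r_into_rtranclp disjI2 shortening.power)
      then show ?thesis using eq True ys by auto
    next
      case False
      then have "ys @ [(k + 1, n)] \<in> suffix_data d n"
        using ys j assms by (auto simp: suffix_data_snoc)
      moreover have "suffix_word n xs @ [n] = suffix_word n (ys @ [(k + 1, n)])"
        using assms unfolding eq by (simp add: power_descending_def descending_Nil)
      ultimately show ?thesis by (metis reduces_refl)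
    qed
  qed
qed

text \<open>Every step used here is a commutation, a braid move or a shortening, so normalising a word never
  makes it longer. This is what will show that canonical words are reduced.\<close>

lemma reduces_to_canonical:
  assumes "1 \<le> d" "1 \<le> n" "w \<in> lists {1..n}"
  shows "\<exists>c\<in>canonical_words d n. reduces d n w c"
  using assms(3)
proof (induction w rule: rev_induct)
  case Nil
  have "[] @ suffix_word n [] \<in> canonical_words d n"
    unfolding canonical_words_def using Nil_in_canonical_prefixes[OF assms(2)] suffix_data_Nil by blast
  then show ?case by auto
next
  case (snoc i w)
  then obtain p xs where IH: "p \<in> canonical_prefixes n" "xs \<in> suffix_data d n"
    "reduces d n w (p @ suffix_word n xs)"
    by (auto simp: canonical_words_def)
  have i: "1 \<le> i" "i \<le> n" using snoc.prems by auto
  have *: "reduces d n (w @ [i]) (p @ suffix_word n xs @ [i])"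
    using reduces_append[OF IH(3), of "[i]" "[i]"] by simp
  have "\<exists>p' xs'. p' \<in> canonical_prefixes n \<and> xs' \<in> suffix_data d n \<and>
      reduces d n (p @ suffix_word n xs @ [i]) (p' @ suffix_word n xs')"
  proof (cases "i = n")
    case True
    obtain xs' where "xs' \<in> suffix_data d n" "reduces d n (suffix_word n xs @ [i]) (suffix_word n xs')"
      using canonical_times_last_letter[OF assms(1,2) IH(2)] True by auto
    then show ?thesis using IH(1) reduces_append[of d n p p] by blast
  next
    case False
    then show ?thesis using canonical_times_letter[OF IH(2,1) i(1)] i by fastforce
  qed
  then show ?case
    unfolding canonical_words_def using reduces_trans[OF *] by blast
qed


section \<open>Reductions do not change the group element\<close>

definition same_element :: "nat \<Rightarrow> nat \<Rightarrow> nat list \<Rightarrow> nat list \<Rightarrow> bool" where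
  "same_element d n u v \<longleftrightarrow>
     (positive u, positive v) \<in> presented_rel {1..n} (reflection_relations d n)"

lemma positive_append [simp]: "positive (u @ v) = positive u @ positive v"
  by (simp add: positive_def)

lemma positive_signed_words [simp]: "positive w \<in> signed_words S \<longleftrightarrow> w \<in> lists S"
  by (auto simp: positive_def signed_words_def)

lemma same_element_refl: "w \<in> lists {1..n} \<Longrightarrow> same_element d n w w"
  by (simp add: same_element_def presented_rel.refl)

lemma same_element_sym: "same_element d n u v \<Longrightarrow> same_element d n v u"
  unfolding same_element_def by (rule presented_rel.sym)

lemma same_element_trans [trans]:
  "same_element d n u v \<Longrightarrow> same_element d n v w \<Longrightarrow> same_element d n u w"
  unfolding same_element_def by (rule presented_rel.trans)

lemma same_element_context:
  assumes "same_element d n u v" "x \<in> lists {1..n}" "z \<in> lists {1..n}"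
  shows "same_element d n (x @ u @ z) (x @ v @ z)"
  using presented_rel_context[OF assms(1)[unfolded same_element_def], of "positive x" "positive z"]
    assms(2,3) by (simp add: same_element_def)

lemma same_element_relation:
  assumes "(u, v) \<in> reflection_relations d n" "u \<in> lists {1..n}" "v \<in> lists {1..n}"
  shows "same_element d n u v"
  using presented_rel.relator[of "[]" "{1..n}" "[]" u v "reflection_relations d n"] assms
  by (simp add: same_element_def signed_words_def)

lemma word_elem_eq_iff:
  assumes "u \<in> lists {1..n}" "v \<in> lists {1..n}"
  shows "word_elem d n u = word_elem d n v \<longleftrightarrow> same_element d n u v"
  unfolding word_elem_def same_element_def
  by (rule eq_equiv_class_iff[OF equiv_presented_rel]) (use assms in simp_all)

lemma square_same_element: "1 \<le> i \<Longrightarrow> i < n \<Longrightarrow> same_element d n [i, i] []"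
  by (rule same_element_relation) (auto simp: reflection_relations_def)

text \<open>Conjugation by \<open>s\<^sub>n\<^sub>-\<^sub>1\<close> is multiplicative, so \<open>s\<^sub>n\<close>, which commutes with
  \<open>s\<^sub>n\<^sub>-\<^sub>1 s\<^sub>n s\<^sub>n\<^sub>-\<^sub>1\<close>, also commutes with \<open>s\<^sub>n\<^sub>-\<^sub>1 s\<^sub>n\<^sup>b s\<^sub>n\<^sub>-\<^sub>1\<close>.\<close>

lemma conjugated_power_commutes:
  assumes "2 \<le> n"
  shows "same_element d n ([n] @ [n - 1] @ replicate b n @ [n - 1])
    (([n - 1] @ replicate b n @ [n - 1]) @ [n])"
proof (induction b)
  case 0
  note sq = square_same_element[of "n - 1" n d]
  have "same_element d n ([n] @ [n - 1, n - 1] @ []) ([n] @ [] @ [])"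
    using assms by (intro same_element_context sq) auto
  also have "same_element d n ([] @ [] @ [n]) ([] @ [n - 1, n - 1] @ [n])"
    using assms by (intro same_element_context same_element_sym[OF sq]) auto
  then have "same_element d n ([n] @ [] @ []) ([] @ [n - 1, n - 1] @ [n])" by simp
  finally show ?case by simp
next
  case (Suc b)
  let ?y = "n - 1" and ?B = "replicate b n"
  have l: "?y \<in> {1..n}" "n \<in> {1..n}" "?B \<in> lists {1..n}" using assms by auto
  have split: "same_element d n ([?y, n, ?y] @ [?y] @ ?B @ [?y]) ([?y] @ replicate (Suc b) n @ [?y])"
    using same_element_context[OF square_same_element[of ?y n d], of "[?y, n]" "?B @ [?y]"] l assms
    by simp
  have one: "same_element d n [n, ?y, n, ?y] [?y, n, ?y, n]"
    using assms by (intro same_element_relation) (auto simp: reflection_relations_def)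
  have "same_element d n ([n] @ ([?y] @ replicate (Suc b) n @ [?y]) @ [])
      ([n] @ ([?y, n, ?y] @ [?y] @ ?B @ [?y]) @ [])"
    using l by (intro same_element_context same_element_sym[OF split]) auto
  also have "same_element d n ([] @ [n, ?y, n, ?y] @ ([?y] @ ?B @ [?y]))
      ([] @ [?y, n, ?y, n] @ ([?y] @ ?B @ [?y]))"
    using l by (intro same_element_context one) auto
  then have "same_element d n ([n] @ ([?y, n, ?y] @ [?y] @ ?B @ [?y]) @ [])
      ([?y, n, ?y] @ ([n] @ [?y] @ ?B @ [?y]) @ [])"
    by simp
  also have "same_element d n ([?y, n, ?y] @ ([n] @ [?y] @ ?B @ [?y]) @ [])
      ([?y, n, ?y] @ (([?y] @ ?B @ [?y]) @ [n]) @ [])"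
    using l by (intro same_element_context Suc.IH) auto
  also have "same_element d n ([] @ ([?y, n, ?y] @ [?y] @ ?B @ [?y]) @ [n])
      ([] @ ([?y] @ replicate (Suc b) n @ [?y]) @ [n])"
    using l by (intro same_element_context split) auto
  then have "same_element d n ([?y, n, ?y] @ (([?y] @ ?B @ [?y]) @ [n]) @ [])
      (([?y] @ replicate (Suc b) n @ [?y]) @ [n])"
    by simp
  finally show ?case by simp
qed

lemma long_braid_same_element:
  assumes "2 \<le> n"
  shows "same_element d n (replicate a n @ [n - 1] @ replicate b n @ [n - 1])
    ([n - 1] @ replicate b n @ [n - 1] @ replicate a n)"
proof (induction a)
  case 0
  show ?case using assms by (auto intro!: same_element_refl)
next
  case (Suc a)
  let ?Y = "[n - 1] @ replicate b n @ [n - 1]"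
  have "same_element d n ([n] @ (replicate a n @ ?Y) @ []) ([n] @ (?Y @ replicate a n) @ [])"
    by (rule same_element_context) (use Suc assms in auto)
  also have "same_element d n ([] @ ([n] @ ?Y) @ replicate a n) ([] @ (?Y @ [n]) @ replicate a n)"
    by (rule same_element_context) (use conjugated_power_commutes assms in auto)
  then have "same_element d n ([n] @ (?Y @ replicate a n) @ []) ([] @ (?Y @ [n]) @ replicate a n)"
    by simp
  finally show ?case by simp
qed

lemma commutation_same_element:
  assumes "(u, v) \<in> commutation n" "u \<in> lists {1..n}"
  shows "v \<in> lists {1..n} \<and> same_element d n u v"
proof -
  obtain x z i j where uv: "u = x @ [i, j] @ z" "v = x @ [j, i] @ z" "i \<in> {1..n}" "j \<in> {1..n}"
    and ij: "j + 1 < i \<or> i + 1 < j"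
    using assms(1) by (auto simp: commutation_def)
  have "same_element d n [i, j] [j, i]"
    using ij
  proof
    assume "j + 1 < i"
    then show ?thesis using uv
      by (intro same_element_relation) (auto simp: reflection_relations_def)
  next
    assume "i + 1 < j"
    then show ?thesis using uv
      by (intro same_element_sym[OF same_element_relation]) (auto simp: reflection_relations_def)
  qed
  then show ?thesis using assms(2) uv same_element_context[of d n "[i, j]" "[j, i]" x z] by auto
qed

lemma braid_move_same_element:
  assumes "braid_move n u v" "u \<in> lists {1..n}"
  shows "v \<in> lists {1..n} \<and> same_element d n u v"
  using assms
proof (induction rule: braid_move.induct)
  case (short_up i x z)
  have "same_element d n [i + 1, i, i + 1] [i, i + 1, i]"
    using short_up by (intro same_element_relation) (auto simp: reflection_relations_def)
  from same_element_context[OF same_element_sym[OF this], of x z] short_up show ?case by auto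
next
  case (short_down i x z)
  have "same_element d n [i + 1, i, i + 1] [i, i + 1, i]"
    using short_down by (intro same_element_relation) (auto simp: reflection_relations_def)
  from same_element_context[OF this, of x z] short_down show ?case by auto
next
  case (long_left a b x z)
  from same_element_context[OF long_braid_same_element[OF long_left(3), of d a b], of x z] long_left
  show ?case by auto
next
  case (long_right a b x z)
  from same_element_context[OF same_element_sym[OF long_braid_same_element[OF long_right(3), of d a b]],
      of x z] long_right
  show ?case by auto
qed

lemma shortening_same_element:
  assumes "shortening d n u v" "u \<in> lists {1..n}"
  shows "v \<in> lists {1..n} \<and> same_element d n u v"
  using assms
proof (induction rule: shortening.induct)
  case (square i x z)
  from same_element_context[OF square_same_element[OF square(1,2)], of x z] square
  show ?case by auto
next
  case (power x z)
  have "same_element d n (replicate d n) []"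
    using power by (intro same_element_relation) (auto simp: reflection_relations_def)
  from same_element_context[OF this, of x z] power show ?case by auto
qed

lemma reduces_same_element:
  assumes "reduces d n u v" "u \<in> lists {1..n}"
  shows "v \<in> lists {1..n} \<and> same_element d n u v"
  using assms(1) unfolding reduces_def
proof (induction rule: rtranclp_induct)
  case base
  show ?case using assms(2) same_element_refl by blast
next
  case (step v w)
  then show ?case
    using commutation_same_element braid_move_same_element shortening_same_element
      same_element_trans by meson
qed

lemma reduces_word_elem:
  "reduces d n u v \<Longrightarrow> u \<in> lists {1..n} \<Longrightarrow> word_elem d n u = word_elem d n v"
  using reduces_same_element word_elem_eq_iff by metis

lemma reduces_length:
  assumes "reduces d n u v" "1 \<le> d"
  shows "length v \<le> length u"
  using assms(1) unfolding reduces_def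
proof (induction rule: rtranclp_induct)
  case (step v w)
  then show ?case
    using commutation_length braid_move_length shortening_length[OF _ assms(2)] by fastforce
qed simp

text \<open>Every generator has finite order, so its inverse is a positive word.\<close>

lemma inverse_letter_positive:
  assumes "1 \<le> d" "a \<in> {1..n}"
  shows "\<exists>w\<in>lists {1..n}. ([(a, False)], positive w) \<in> presented_rel {1..n} (reflection_relations d n)"
proof -
  have rel: "same_element d n (a # w) [] \<Longrightarrow> w \<in> lists {1..n} \<Longrightarrow>
      ([(a, False)], positive w) \<in> presented_rel {1..n} (reflection_relations d n)" for w
  proof -
    assume *: "same_element d n (a # w) []" "w \<in> lists {1..n}"
    have s: "[(a, False)] \<in> signed_words {1..n}" using assms by (auto simp: signed_words_def)
    have "([(a, False)] @ positive (a # w) @ [], [(a, False)] @ positive [] @ [])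
        \<in> presented_rel {1..n} (reflection_relations d n)"
      using *(1) s unfolding same_element_def
      by (intro presented_rel_context) (auto simp: signed_words_def)
    moreover have "([] @ [(a, False), (a, \<not> False)] @ positive w, [] @ positive w)
        \<in> presented_rel {1..n} (reflection_relations d n)"
      using *(2) assms by (intro presented_rel.cancel) (auto simp: signed_words_def positive_def)
    ultimately show ?thesis
      by (auto simp: positive_def intro: presented_rel.trans presented_rel.sym)
  qed
  show ?thesis
  proof (cases "a = n")
    case True
    have "same_element d n (replicate d n) []"
      using assms True by (intro same_element_relation) (auto simp: reflection_relations_def)
    then have "same_element d n (a # replicate (d - 1) n) []"
      using assms(1) True by (cases d) auto
    moreover have "replicate (d - 1) n \<in> lists {1..n}"
      using assms True by (auto simp: in_lists_conv_set)
    ultimately show ?thesis using rel True by blast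
  next
    case False
    then show ?thesis using rel[of "[a]"] square_same_element[of a n d] assms
      by (intro bexI[of _ "[a]"]) auto
  qed
qed

lemma positive_representative:
  assumes "1 \<le> d" "u \<in> signed_words {1..n}"
  shows "\<exists>w\<in>lists {1..n}. (u, positive w) \<in> presented_rel {1..n} (reflection_relations d n)"
  using assms(2)
proof (induction u)
  case Nil
  show ?case by (intro bexI[of _ "[]"]) (auto simp: positive_def signed_words_def intro: presented_rel.refl)
next
  case (Cons x u)
  obtain a b where x: "x = (a, b)" by (cases x)
  have a: "a \<in> {1..n}" and u: "u \<in> signed_words {1..n}" using Cons.prems by (auto simp: x signed_words_def)
  obtain w where w: "w \<in> lists {1..n}" "(u, positive w) \<in> presented_rel {1..n} (reflection_relations d n)"
    using Cons.IH[OF u] by blast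
  have "\<exists>v\<in>lists {1..n}. ([x], positive v) \<in> presented_rel {1..n} (reflection_relations d n)"
  proof (cases b)
    case True
    then show ?thesis using a presented_rel.refl[of "[x]" "{1..n}"]
      by (intro bexI[of _ "[a]"]) (auto simp: x positive_def signed_words_def)
  next
    case False
    then show ?thesis using inverse_letter_positive[OF assms(1) a] x by simp
  qed
  then obtain v where v: "v \<in> lists {1..n}"
    "([x], positive v) \<in> presented_rel {1..n} (reflection_relations d n)" by blast
  have "([x] @ u, positive v @ positive w) \<in> presented_rel {1..n} (reflection_relations d n)"
    by (rule presented_rel_append[OF v(2) w(2)])
  then show ?case using v w by (intro bexI[of _ "v @ w"]) auto
qed

lemma reflection_group_carrier:
  assumes "1 \<le> d"
  shows "carrier (reflection_group d n) = word_elem d n ` lists {1..n}"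
proof
  show "carrier (reflection_group d n) \<subseteq> word_elem d n ` lists {1..n}"
  proof
    fix g assume "g \<in> carrier (reflection_group d n)"
    then obtain u where u: "u \<in> signed_words {1..n}"
      and g: "g = presented_rel {1..n} (reflection_relations d n) `` {u}"
      by (auto simp: reflection_group_def presented_group_def quotient_def)
    obtain w where w: "w \<in> lists {1..n}"
      "(u, positive w) \<in> presented_rel {1..n} (reflection_relations d n)"
      using positive_representative[OF assms u] by blast
    have "g = word_elem d n w"
      unfolding g word_elem_def by (rule equiv_class_eq[OF equiv_presented_rel w(2)])
    then show "g \<in> word_elem d n ` lists {1..n}" using w by blast
  qed
  show "word_elem d n ` lists {1..n} \<subseteq> carrier (reflection_group d n)"
    by (auto simp: reflection_group_def presented_group_def word_elem_def intro!: quotientI)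
qed


section \<open>Distinct canonical words represent distinct elements\<close>

text \<open>The action of \<open>G(d,1,n)\<close> on \<open>d\<close>-coloured positions: \<open>s\<^sub>i\<close> with \<open>i < n\<close> exchanges the
  positions \<open>i\<close> and \<open>i + 1\<close>, and \<open>s\<^sub>n\<close> changes the colour at position \<open>n\<close>. The defining relations
  hold on the pairs whose colour is less than \<open>d\<close>.\<close>

fun letter_action :: "nat \<Rightarrow> nat \<Rightarrow> nat \<times> bool \<Rightarrow> nat \<times> nat \<Rightarrow> nat \<times> nat" where
  "letter_action d n (a, b) (p, c) =
     (if a = n then (if p = n then (p, (if b then c + 1 else c + (d - 1)) mod d) else (p, c))
      else if p = a then (a + 1, c) else if p = a + 1 then (a, c) else (p, c))"

definition word_action :: "nat \<Rightarrow> nat \<Rightarrow> nat list \<Rightarrow> nat \<times> nat \<Rightarrow> nat \<times> nat" where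
  "word_action d n w = foldr (letter_action d n) (positive w)"

lemma word_action_simps [simp]:
  "word_action d n [] x = x"
  "word_action d n (a # w) x = letter_action d n (a, True) (word_action d n w x)"
  "word_action d n (u @ v) x = word_action d n u (word_action d n v x)"
  by (simp_all add: word_action_def positive_def)

lemma letter_action_colour: "snd x < d \<Longrightarrow> snd (letter_action d n (a, b) x) < d"
  by (cases x) auto

lemma signed_action_colour: "snd x < d \<Longrightarrow> snd (foldr (letter_action d n) u x) < d"
proof (induction u)
  case (Cons l u)
  then show ?case by (cases l) (auto intro: letter_action_colour)
qed simp

lemma letter_action_cancel:
  assumes "snd x < d"
  shows "letter_action d n (a, b) (letter_action d n (a, \<not> b) x) = x"
proof -
  obtain p c where x: "x = (p, c)" by (cases x)
  have "(c + (d - 1)) mod d = c - 1" if "c \<noteq> 0"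
  proof -
    have "c + (d - 1) = (c - 1) + d" using that assms by (simp add: x)
    then have "(c + (d - 1)) mod d = (c - 1) mod d" by simp
    then show ?thesis using assms by (simp add: x)
  qed
  then have "(c + (d - 1)) mod d + 1 = (if c = 0 then d else c)"
    "(c + 1) mod d + (d - 1) = (if c + 1 = d then d - 1 else c + d)"
    using assms by (auto simp: x)
  then have "((c + (d - 1)) mod d + 1) mod d = c" "((c + 1) mod d + (d - 1)) mod d = c"
    using assms by (auto simp: x)
  then show ?thesis by (cases b) (auto simp: x)
qed

lemma word_action_replicate:
  "c < d \<Longrightarrow> word_action d n (replicate k n) (p, c) = (p, if p = n then (c + k) mod d else c)"
  by (induction k) (auto simp: mod_Suc_eq)

lemma presented_rel_action:
  assumes "(u, v) \<in> presented_rel {1..n} (reflection_relations d n)" "snd x < d"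
  shows "foldr (letter_action d n) u x = foldr (letter_action d n) v x"
  using assms
proof (induction arbitrary: x rule: presented_rel.induct)
  case (cancel u v a b)
  then show ?case using letter_action_cancel signed_action_colour by simp
next
  case (relator u v w w')
  let ?y = "foldr (letter_action d n) v x"
  obtain p c where pc: "?y = (p, c)" by (cases ?y)
  have c: "c < d" using signed_action_colour[OF relator.prems, of n v] pc by simp
  have "word_action d n w (p, c) = word_action d n w' (p, c)"
    using relator.hyps(5) word_action_replicate[OF c, of n d p] c
    unfolding reflection_relations_def by auto
  then show ?case by (simp add: pc word_action_def)
qed auto

lemma same_element_action:
  "same_element d n u v \<Longrightarrow> snd x < d \<Longrightarrow> word_action d n u x = word_action d n v x"
  unfolding same_element_def word_action_def by (rule presented_rel_action)

lemma word_action_surj: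
  assumes "snd y < d"
  shows "\<exists>x. snd x < d \<and> word_action d n w x = y"
  using assms
proof (induction w arbitrary: y)
  case (Cons a w)
  obtain x where x: "snd x < d" "word_action d n w x = letter_action d n (a, False) y"
    using Cons letter_action_colour by blast
  then have "word_action d n (a # w) x = y"
    using letter_action_cancel[OF Cons.prems, of n a True] by simp
  then show ?case using x by blast
qed auto

lemma word_action_cancel_right:
  assumes "\<And>x. snd x < d \<Longrightarrow> word_action d n (u @ w) x = word_action d n (u' @ w) x" "snd y < d"
  shows "word_action d n u y = word_action d n u' y"
  using word_action_surj[OF assms(2), of n w] assms(1) by auto

lemma word_action_descending:
  assumes "1 \<le> j" "j \<le> m + 1" "m < n"
  shows "word_action d n (descending m j) (p, c) =
    (if p = j then m + 1 else if j < p \<and> p \<le> m + 1 then p - 1 else p, c)"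
  using assms
proof (induction m)
  case 0
  then show ?case by (simp add: descending_Nil)
next
  case (Suc m)
  show ?case
  proof (cases "j = Suc m + 1")
    case True
    then show ?thesis by (simp add: descending_Nil)
  next
    case False
    then show ?thesis using Suc descending_Cons[of j "Suc m"] by auto
  qed
qed

lemma word_action_power_descending:
  assumes "1 \<le> j" "j \<le> n" "c < d"
  shows "word_action d n (power_descending n k j) (p, c) =
    (if p = j then (n, (c + k) mod d) else (if j < p \<and> p \<le> n then p - 1 else p, c))"
  using assms by (auto simp: power_descending_def word_action_descending word_action_replicate)

text \<open>The blocks act from the last to the first. The block that ends at \<open>j\<close> brings position \<open>j\<close> to \<open>n\<close>
  and gives it its colour there, while the blocks before it have smaller ends and hence do not colour
  position \<open>n\<close> any more. So a suffix gives the colour \<open>k\<close> to the positions \<open>j\<close> of its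
  blocks \<open>(k, j)\<close> and leaves the other colours unchanged.\<close>

lemma suffix_action_colour:
  assumes "xs \<in> suffix_data d n" "1 \<le> p" "p \<le> n" "c < d"
  shows "(k, p) \<in> set xs \<longrightarrow> snd (word_action d n (suffix_word n xs) (p, c)) = (c + k) mod d"
    and "p \<notin> snd ` set xs \<longrightarrow> snd (word_action d n (suffix_word n xs) (p, c)) = c"
  using assms
proof (induction xs arbitrary: p c k rule: rev_induct)
  case (snoc x xs)
  obtain a j where x: "x = (a, j)" by (cases x)
  {
    case 1
    have xs: "xs \<in> suffix_data d n" "\<forall>j'\<in>snd ` set xs. j' < j" and j: "1 \<le> j" "j \<le> n"
      using 1 by (auto simp: x suffix_data_snoc)
    show ?case
    proof
      assume k: "(k, p) \<in> set (xs @ [x])"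
      show "snd (word_action d n (suffix_word n (xs @ [x])) (p, c)) = (c + k) mod d"
      proof (cases "p = j")
        case True
        then have "k = a" using k xs by (force simp: x)
        then show ?thesis
          using True snoc.IH(2)[of n "(c + a) mod d"] xs j 1 by (force simp: x word_action_power_descending)
      next
        case False
        then have "(k, p) \<in> set xs" using k by (simp add: x)
        moreover from this have "p < j" using xs by force
        ultimately show ?thesis
          using snoc.IH(1)[of p c k] xs j 1 by (auto simp: x word_action_power_descending)
      qed
    qed
  next
    case 2
    have xs: "xs \<in> suffix_data d n" "\<forall>j'\<in>snd ` set xs. j' < j" and j: "1 \<le> j" "j \<le> n"
      using 2 by (auto simp: x suffix_data_snoc)
    show ?case
    proof
      assume p: "p \<notin> snd ` set (xs @ [x])"
      then have "p \<noteq> j" by (force simp: x)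
      moreover have "j < p \<Longrightarrow> p - 1 \<notin> snd ` set xs" using xs by force
      ultimately show "snd (word_action d n (suffix_word n (xs @ [x])) (p, c)) = c"
        using p snoc.IH(2)[of p c] snoc.IH(2)[of "p - 1" c] xs j 2
        by (auto simp: x word_action_power_descending)
    qed
  }
qed auto

lemma prefix_action_colour:
  assumes "set w \<subseteq> {1..<n}"
  shows "snd (word_action d n w x) = snd x"
  using assms
proof (induction w)
  case (Cons a w)
  obtain p c where "word_action d n w x = (p, c)" by (cases "word_action d n w x")
  then show ?case using Cons by auto
qed simp

lemma word_action_position:
  assumes "set w \<subseteq> {1..<m}" "m \<le> n"
  shows "fst (word_action d n w x) \<le> m \<longleftrightarrow> fst x \<le> m"
  using assms
proof (induction w)
  case (Cons a w)
  obtain p c where "word_action d n w x = (p, c)" by (cases "word_action d n w x")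
  then show ?case using Cons by auto
qed simp

text \<open>The end \<open>q\<close> of the last run is the position that the word brings to \<open>m + 1\<close>.\<close>

lemma canonical_prefix_action_inj:
  assumes "1 \<le> m" "m \<le> n" "1 \<le> d" "w \<in> canonical_prefixes m" "w' \<in> canonical_prefixes m"
    and "\<And>x. snd x < d \<Longrightarrow> word_action d n w x = word_action d n w' x"
  shows "w = w'"
  using assms
proof (induction m arbitrary: w w' rule: dec_induct)
  case base
  then show ?case by (simp add: canonical_prefixes_1)
next
  case (step m)
  obtain u q where w: "w = u @ descending m q" and u: "u \<in> canonical_prefixes m"
    and q: "1 \<le> q" "q \<le> m + 1"
    using step.prems(3) by (auto simp: canonical_prefixes_Suc[OF step.hyps(1)])
  obtain u' q' where w': "w' = u' @ descending m q'" and u': "u' \<in> canonical_prefixes m"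
    and q': "1 \<le> q'" "q' \<le> m + 1"
    using step.prems(4) by (auto simp: canonical_prefixes_Suc[OF step.hyps(1)])
  have "q = q'"
  proof (rule ccontr)
    assume "q \<noteq> q'"
    have "fst (word_action d n w (q, 0)) \<le> m \<longleftrightarrow> m + 1 \<le> m"
      using word_action_position[OF canonical_prefix_letters[OF u], of n d] step.prems q
      by (simp add: w word_action_descending)
    moreover have "fst (word_action d n w' (q, 0)) \<le> m"
      using word_action_position[OF canonical_prefix_letters[OF u'], of n d] step.prems q q' \<open>q \<noteq> q'\<close>
      by (auto simp: w' word_action_descending)
    ultimately show False using step.prems(5)[of "(q, 0)"] \<open>1 \<le> d\<close> by simp
  qed
  moreover have "u = u'"
  proof (rule step.IH[OF _ \<open>1 \<le> d\<close> u u'])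
    show "m \<le> n" using step.prems by simp
    show "word_action d n u x = word_action d n u' x" if "snd x < d" for x
      using word_action_cancel_right[of d n u "descending m q" u' x] step.prems(5) that
      by (simp add: w w' \<open>q = q'\<close>)
  qed
  ultimately show ?case by (simp add: w w')
qed

lemma suffix_data_eqI:
  assumes "xs \<in> suffix_data d n" "ys \<in> suffix_data d n" "set xs = set ys"
  shows "xs = ys"
proof (rule map_sorted_distinct_set_unique)
  show "inj_on snd (set xs \<union> set ys)"
    using assms by (simp add: suffix_data_def strict_sorted_iff distinct_map)
qed (use assms in \<open>auto simp: suffix_data_def strict_sorted_iff\<close>)

text \<open>A prefix does not change colours, so the colours of the image determine the suffix; after
  cancelling it, the permutation of the positions determines the prefix.\<close>

lemma canonical_word_unique:
  assumes "1 \<le> d" "1 \<le> n" "p \<in> canonical_prefixes n" "p' \<in> canonical_prefixes n"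
    and xs: "xs \<in> suffix_data d n" "xs' \<in> suffix_data d n"
    and eq: "same_element d n (p @ suffix_word n xs) (p' @ suffix_word n xs')"
  shows "p = p' \<and> xs = xs'"
proof -
  have act: "word_action d n (p @ suffix_word n xs) x = word_action d n (p' @ suffix_word n xs') x"
    if "snd x < d" for x
    using same_element_action[OF eq that] .
  have colours: "(k, j) \<in> set ys \<longleftrightarrow>
      1 \<le> j \<and> j \<le> n \<and> k \<noteq> 0 \<and> snd (word_action d n (q @ suffix_word n ys) (j, 0)) = k"
    if ys: "ys \<in> suffix_data d n" and q: "q \<in> canonical_prefixes n" for k j ys q
  proof (cases "1 \<le> j \<and> j \<le> n")
    case True
    have eq: "snd (word_action d n (q @ suffix_word n ys) (j, 0)) =
        snd (word_action d n (suffix_word n ys) (j, 0))"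
      using prefix_action_colour[OF canonical_prefix_letters[OF q]] by simp
    show ?thesis
    proof (cases "\<exists>k'. (k', j) \<in> set ys")
      case ex: True
      then obtain k' where k': "(k', j) \<in> set ys" by blast
      have "snd (word_action d n (suffix_word n ys) (j, 0)) = k'' \<and> k'' \<noteq> 0"
        if "(k'', j) \<in> set ys" for k''
      proof -
        have "1 \<le> k''" "k'' < d" using that ys assms(1) by (fastforce simp: suffix_data_def)+
        then show ?thesis using suffix_action_colour(1)[OF ys, of j 0 k''] that True assms(1) by simp
      qed
      then show ?thesis using True k' unfolding eq by blast
    next
      case False
      then have "j \<notin> snd ` set ys" by auto
      then show ?thesis
        using suffix_action_colour(2)[OF ys, of j 0] True False assms(1) unfolding eq by auto
    qed
  next
    case False
    then show ?thesis using ys by (auto simp: suffix_data_def)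
  qed
  have "set xs = set xs'"
    using colours[OF xs(1) assms(3)] colours[OF xs(2) assms(4)] act assms(1) by auto
  then have xs_eq: "xs = xs'" using suffix_data_eqI xs by blast
  have "word_action d n p x = word_action d n p' x" if "snd x < d" for x
    using word_action_cancel_right[of d n p "suffix_word n xs" p' x] act that by (simp add: xs_eq)
  then have "p = p'"
    using canonical_prefix_action_inj[of n n d p p'] assms by auto
  with xs_eq show ?thesis by simp
qed

lemma suffix_word_letters: "xs \<in> suffix_data d n \<Longrightarrow> suffix_word n xs \<in> lists {1..n}"
  by (fastforce simp: suffix_data_def suffix_word_def power_descending_def)

lemma canonical_word_letters:
  assumes "w \<in> canonical_words d n"
  shows "w \<in> lists {1..n}"
proof -
  obtain p xs where "w = p @ suffix_word n xs" "p \<in> canonical_prefixes n" "xs \<in> suffix_data d n"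
    using assms by (auto simp: canonical_words_def)
  then show ?thesis using canonical_prefix_letters[of p n] suffix_word_letters[of xs d n] by fastforce
qed

lemma word_elem_canonical_inj:
  assumes "1 \<le> d" "1 \<le> n"
  shows "inj_on (word_elem d n) (canonical_words d n)"
proof (rule inj_onI)
  fix v w assume vw: "v \<in> canonical_words d n" "w \<in> canonical_words d n"
    and "word_elem d n v = word_elem d n w"
  then have "same_element d n v w"
    using word_elem_eq_iff canonical_word_letters by metis
  then show "v = w"
    using vw canonical_word_unique[OF assms] unfolding canonical_words_def by blast
qed

lemma reduces_to_canonical_representative:
  assumes "1 \<le> d" "1 \<le> n" "c \<in> canonical_words d n" "v \<in> lists {1..n}"
    "word_elem d n v = word_elem d n c"
  shows "reduces d n v c"
proof -
  obtain c' where c': "c' \<in> canonical_words d n" "reduces d n v c'"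
    using reduces_to_canonical[OF assms(1,2,4)] by blast
  then have "word_elem d n v = word_elem d n c'"
    using reduces_word_elem assms(4) by blast
  then show ?thesis
    using inj_onD[OF word_elem_canonical_inj[OF assms(1,2)], of c' c] c' assms(3,5) by metis
qed

text \<open>Any other word for the same element reduces to the canonical word and is thus at least as long.\<close>

lemma canonical_word_reduced:
  assumes "1 \<le> d" "1 \<le> n" "c \<in> canonical_words d n"
  shows "c \<in> reduced_expressions d n (word_elem d n c)"
  using assms canonical_word_letters reduces_to_canonical_representative reduces_length
  unfolding reduced_expressions_def by blast

lemma carrier_canonical:
  assumes "1 \<le> d" "1 \<le> n"
  shows "carrier (reflection_group d n) = word_elem d n ` canonical_words d n"
proof -
  have "word_elem d n v \<in> word_elem d n ` canonical_words d n" if v: "v \<in> lists {1..n}" for v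
  proof -
    obtain c where "c \<in> canonical_words d n" "reduces d n v c"
      using reduces_to_canonical[OF assms v] by blast
    then show ?thesis using reduces_word_elem[OF _ v] by blast
  qed
  then show ?thesis
    unfolding reflection_group_carrier[OF assms(1)] using canonical_word_letters by blast
qed


section \<open>Full commutativity as absence of braid moves\<close>

definition braid_free :: "nat \<Rightarrow> nat list \<Rightarrow> bool" where
  "braid_free n w \<longleftrightarrow> (\<forall>w' v. comm_equiv n w w' \<longrightarrow> \<not> braid_move n w' v)"

text \<open>Commuting letters never both lie in a pair of neighbours \<open>i, i + 1\<close>, so commutations preserve
  the subword of letters from such a pair; a braid move changes it.\<close>

lemma commutation_filter:
  assumes "(u, v) \<in> commutation n"
  shows "filter (\<lambda>a. a = i \<or> a = i + 1) u = filter (\<lambda>a. a = i \<or> a = i + 1) v"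
proof -
  obtain x z a b where "u = x @ [a, b] @ z" "v = x @ [b, a] @ z" "b + 1 < a \<or> a + 1 < b"
    using assms by (auto simp: commutation_def)
  then show ?thesis by auto
qed

lemma comm_equiv_filter:
  assumes "comm_equiv n u v"
  shows "filter (\<lambda>a. a = i \<or> a = i + 1) u = filter (\<lambda>a. a = i \<or> a = i + 1) v"
  using assms unfolding comm_equiv_def
  by (induction rule: rtrancl_induct) (auto dest: commutation_filter)

lemma braid_move_not_comm_equiv:
  assumes "braid_move n u v"
  shows "\<not> comm_equiv n u v"
  using assms
proof (induction rule: braid_move.induct)
  case (short_up i x z)
  show ?case using comm_equiv_filter[of n _ _ i] by fastforce
next
  case (short_down i x z)
  show ?case using comm_equiv_filter[of n _ _ i] by fastforce
next
  case (long_left a b x z)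
  then obtain a' where "a = Suc a'" by (cases a) auto
  then show ?case using comm_equiv_filter[of n _ _ "n - 1"] long_left by fastforce
next
  case (long_right a b x z)
  then obtain a' where "a = Suc a'" by (cases a) auto
  then show ?case using comm_equiv_filter[of n _ _ "n - 1"] long_right by fastforce
qed

lemma comm_equiv_length: "comm_equiv n u v \<Longrightarrow> length u = length v"
  unfolding comm_equiv_def by (induction rule: rtrancl_induct) (auto dest: commutation_length)

text \<open>Between words of equal length a reduction contains no shortening. Read backwards from \<open>c\<close>, it
  consists of commutations, because no word reached in this way admits a braid move.\<close>

lemma length_preserving_reduction:
  assumes "1 \<le> d" "braid_free n c" "reduces d n v c" "length v = length c"
  shows "comm_equiv n v c"
  using assms(3,4) unfolding reduces_def
proof (induction rule: converse_rtranclp_induct)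
  case (step v v')
  have *: "reduces d n v' c" using step.hyps by (simp add: reduces_def)
  then have len: "length v = length v'" "length v' = length c"
    using reduces_length[OF * assms(1)] step.hyps(1) step.prems commutation_length braid_move_length
      shortening_length[OF _ assms(1)] by fastforce+
  then have v': "comm_equiv n v' c" using step.IH by simp
  have "\<not> shortening d n v v'" using shortening_length[OF _ assms(1)] len by fastforce
  moreover have "\<not> braid_move n v v'"
    using assms(2) v' comm_equiv_sym braid_move_sym unfolding braid_free_def by blast
  ultimately have "(v, v') \<in> commutation n" using step.hyps(1) by blast
  then show ?case using v' unfolding comm_equiv_def by (rule converse_rtrancl_into_rtrancl)
qed simp

text \<open>If a braid move applies to a word that is commutation equivalent to \<open>c\<close>, its two sides are
  reduced expressions of the same element that differ by more than commutations.\<close>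

theorem fully_commutative_iff_braid_free:
  assumes "1 \<le> d" "1 \<le> n" "c \<in> canonical_words d n"
  shows "fully_commutative d n (word_elem d n c) \<longleftrightarrow> braid_free n c"
proof
  assume fc: "fully_commutative d n (word_elem d n c)"
  show "braid_free n c"
    unfolding braid_free_def
  proof (intro allI impI notI)
    fix w v assume w: "comm_equiv n c w" and v: "braid_move n w v"
    have c: "c \<in> lists {1..n}" using assms canonical_word_letters by blast
    have wl: "w \<in> lists {1..n} \<and> same_element d n c w"
      using reduces_same_element[OF braid_equiv_imp_reduces[OF comm_equiv_imp_braid_equiv[OF w]] c] .
    have vl: "v \<in> lists {1..n} \<and> same_element d n w v"
      using braid_move_same_element[OF v] wl by blast
    have "word_elem d n w = word_elem d n c" "word_elem d n v = word_elem d n c"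
      using c wl vl word_elem_eq_iff by metis+
    moreover have "length w = length c" "length v = length c"
      using comm_equiv_length[OF w] braid_move_length[OF v] by simp_all
    ultimately have "w \<in> reduced_expressions d n (word_elem d n c)"
      "v \<in> reduced_expressions d n (word_elem d n c)"
      using canonical_word_reduced[OF assms] wl vl by (simp_all add: reduced_expressions_def)
    then show False
      using fc braid_move_not_comm_equiv[OF v] by (simp add: fully_commutative_def comm_equiv_def)
  qed
next
  assume bf: "braid_free n c"
  have "comm_equiv n v c" if v: "v \<in> reduced_expressions d n (word_elem d n c)" for v
  proof (rule length_preserving_reduction[OF assms(1) bf])
    show "reduces d n v c"
      using v reduces_to_canonical_representative[OF assms] by (simp add: reduced_expressions_def)
    show "length v = length c"
      using v canonical_word_reduced[OF assms] unfolding reduced_expressions_def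
      by (metis (mono_tags, lifting) le_antisym mem_Collect_eq)
  qed
  then show "fully_commutative d n (word_elem d n c)"
    unfolding fully_commutative_def comm_equiv_def [symmetric]
    using comm_equiv_trans comm_equiv_sym by blast
qed


section \<open>Canonical words that admit a braid move\<close>

lemma braid_free_comm_equiv:
  assumes "comm_equiv n u v"
  shows "braid_free n u \<longleftrightarrow> braid_free n v"
  unfolding braid_free_def using assms comm_equiv_trans comm_equiv_sym by blast

lemma braid_free_factor: "braid_free n (x @ u @ z) \<Longrightarrow> braid_free n u"
  unfolding braid_free_def using comm_equiv_context braid_move_context by blast

text \<open>The letter \<open>i\<close> commutes with everything up to the letter \<open>i + 1\<close> of the run, and there
  \<open>i, i + 1, i\<close> appears.\<close>

lemma descending_overlap:
  assumes "1 \<le> j" "j \<le> i" "i + 1 \<le> m" "m < n"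
    and y: "\<And>a. a \<in> set y \<Longrightarrow> a \<in> {1..n} \<and> (a + 1 < i \<or> i + 1 < a)"
  shows "\<not> braid_free n ([i] @ y @ descending m j)"
proof -
  let ?y = "y @ descending m (i + 2)" and ?t = "descending (i - 1) j"
  have eq: "descending m j = descending m (i + 2) @ [i + 1, i] @ ?t"
    using assms descending_split[of "i + 2" j m] descending_Cons[of j "i + 1"] descending_Cons[of j i]
    by simp
  have "comm_equiv n (?y @ [i]) ([i] @ ?y)"
    using assms by (intro comm_equiv_letter) auto
  then have "comm_equiv n ([] @ (?y @ [i]) @ [i + 1, i] @ ?t) ([] @ ([i] @ ?y) @ [i + 1, i] @ ?t)"
    by (rule comm_equiv_context)
  moreover have "\<not> braid_free n (?y @ [i, i + 1, i] @ ?t)"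
    using braid_move.short_up[of i n ?y ?t] assms unfolding braid_free_def by fastforce
  ultimately show ?thesis using braid_free_comm_equiv by (simp add: eq)
qed

text \<open>The second group of letters \<open>n\<close> commutes with the part of the run below \<open>n - 1\<close>, and a long
  braid move becomes possible.\<close>

lemma last_letter_overlap:
  assumes "1 \<le> j" "j < n" "1 \<le> a" "1 \<le> b"
  shows "\<not> braid_free n ([n - 1] @ replicate a n @ descending (n - 1) j @ replicate b n)"
proof -
  let ?A = "replicate a n" and ?B = "replicate b n" and ?E = "descending (n - 1 - 1) j"
  have "comm_equiv n (?E @ ?B) (?B @ ?E)"
    using assms by (intro comm_equiv_words) auto
  then have "comm_equiv n (([n - 1] @ ?A @ [n - 1]) @ (?E @ ?B) @ [])
      (([n - 1] @ ?A @ [n - 1]) @ (?B @ ?E) @ [])"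
    by (rule comm_equiv_context)
  moreover have "\<not> braid_free n ([] @ [n - 1] @ ?A @ [n - 1] @ ?B @ ?E)"
    using braid_move.long_right[of b a n "[]" ?E] assms unfolding braid_free_def by fastforce
  ultimately show ?thesis
    using braid_free_comm_equiv assms descending_Cons[of j "n - 1"] by simp
qed

text \<open>The words of \<open>jones r j\<close> are the normal forms of the fully commutative elements of the
  symmetric group: products of descending runs \<open>s\<^sub>p \<dots> s\<^sub>q\<close> in which both \<open>p\<close> and \<open>q\<close> increase
  strictly, here with all \<open>p < r\<close> and all \<open>q < j\<close>.\<close>

fun jones :: "nat \<Rightarrow> nat \<Rightarrow> nat list set" where
  "jones 0 j = {[]}"
| "jones (Suc r) j =
     jones r j \<union> (\<Union>q\<in>{1..<j} \<inter> {..r}. (\<lambda>u. u @ descending r q) ` jones r q)"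

lemma jones_letters: "w \<in> jones r j \<Longrightarrow> set w \<subseteq> {1..<r}"
  by (induction r arbitrary: w j) fastforce+

lemma jones_last: "w \<in> jones r j \<Longrightarrow> w \<noteq> [] \<Longrightarrow> last w < j"
proof (induction r arbitrary: w j)
  case (Suc r)
  have "last (descending r q) = q" "descending r q \<noteq> []" if "q \<le> r" for q
    using descending_snoc[OF that] by simp_all
  then show ?case using Suc by auto
qed simp

lemma Nil_in_jones [simp]: "[] \<in> jones r j"
  by (induction r) auto

lemma jones_mono_end: "j \<le> k \<Longrightarrow> jones r j \<subseteq> jones r k"
  by (induction r) force+

lemma jones_saturated: "r \<le> j \<Longrightarrow> jones r j = jones r r"
proof (induction r arbitrary: j)
  case (Suc r)
  have "{1..<j} \<inter> {..r} = {1..<Suc r} \<inter> {..r}" using Suc.prems by auto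
  moreover have "jones r j = jones r (Suc r)" using Suc.IH[of j] Suc.IH[of "Suc r"] Suc.prems by simp
  ultimately show ?case by simp
qed simp

lemma jones_subset_canonical: "1 \<le> r \<Longrightarrow> jones r j \<subseteq> canonical_prefixes r"
proof (induction r arbitrary: j rule: dec_induct)
  case base
  then show ?case by (simp add: canonical_prefixes_1)
next
  case (step r)
  have "u \<in> canonical_prefixes (Suc r)" if "u \<in> jones r j" for u
  proof -
    have "u = u @ descending r (r + 1)" by (simp add: descending_Nil)
    then show ?thesis
      using step.IH[of j] step.hyps that by (fastforce simp: canonical_prefixes_Suc)
  qed
  moreover have "u @ descending r q \<in> canonical_prefixes (Suc r)"
    if "u \<in> jones r q" "1 \<le> q" "q \<le> r" for u q
    using step.IH[of q] step.hyps that by (fastforce simp: canonical_prefixes_Suc)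
  ultimately show ?case by auto
qed

lemma jones_last_block:
  assumes "w \<in> jones r j" "w \<notin> jones r k"
  obtains u p q where "w = u @ descending p q" "u \<in> jones p q" "1 \<le> q" "k \<le> q" "q \<le> p" "p < r" "q < j"
  using assms
proof (induction r arbitrary: thesis)
  case (Suc r)
  show ?case
  proof (cases "w \<in> jones r j")
    case True
    then show ?thesis using Suc.IH[of thesis] Suc.prems by auto
  next
    case False
    then obtain q u where *: "w = u @ descending r q" "u \<in> jones r q" "1 \<le> q" "q < j" "q \<le> r"
      using Suc.prems(2) by auto
    then have "k \<le> q" using Suc.prems(3) by (auto simp: not_le[symmetric])
    then show ?thesis using Suc.prems(1) * by blast
  qed
qed simp

text \<open>Two neighbouring runs whose ends do not increase overlap in the sense of
  \<open>descending_overlap\<close>.\<close>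

lemma braid_free_prefix:
  assumes "1 \<le> r" "r \<le> n" "w \<in> canonical_prefixes r" "braid_free n w"
  shows "w \<in> jones r r"
  using assms
proof (induction r arbitrary: w rule: dec_induct)
  case base
  then show ?case by (simp add: canonical_prefixes_1)
next
  case (step r)
  obtain u q where w: "w = u @ descending r q" and u: "u \<in> canonical_prefixes r"
    and q: "1 \<le> q" "q \<le> r + 1"
    using step.prems(2) by (auto simp: canonical_prefixes_Suc[OF step.hyps(1)])
  have "braid_free n u" using braid_free_factor[of n "[]" u "descending r q"] step.prems by (simp add: w)
  then have uj: "u \<in> jones r r" using step u by simp
  show ?case
  proof (cases "q = r + 1")
    case True
    then have "w = u" by (simp add: w descending_Nil)
    then show ?thesis using uj jones_mono_end[of r "Suc r" r] by auto
  next
    case False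
    have "u \<in> jones r q"
    proof (rule ccontr)
      assume "u \<notin> jones r q"
      with uj obtain u' p q' where u': "u = u' @ descending p q'" "1 \<le> q'" "q \<le> q'" "q' \<le> p" "p < r"
        by (rule jones_last_block)
      have "\<not> braid_free n ([q'] @ [] @ descending r q)"
        using u' q step by (intro descending_overlap) auto
      then show False
        using braid_free_factor[of n "u' @ descending p (q' + 1)" "[q'] @ [] @ descending r q" "[]"]
          step.prems(3) descending_snoc[of q' p] u' by (simp add: w)
    qed
    then show ?thesis using False q by (auto simp: w)
  qed
qed

text \<open>With a single block \<open>s\<^sub>n\<^sup>t s\<^sub>n\<^sub>-\<^sub>1 \<dots> s\<^sub>j\<close> as suffix, the runs of the prefix that end at \<open>j\<close> or
  above have to be the single letters \<open>s\<^sub>r, \<dots>, s\<^sub>n\<^sub>-\<^sub>1\<close>: then every letter \<open>s\<^sub>i\<close> with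
  \<open>i \<ge> r\<close> is separated from its second occurrence by two letters \<open>s\<^sub>i\<^sub>+\<^sub>1\<close> or by all letters
  \<open>s\<^sub>n\<close>.\<close>

definition ascending_tails :: "nat \<Rightarrow> nat \<Rightarrow> nat list set" where
  "ascending_tails n j = (\<Union>r\<in>{j..n}. (\<lambda>u. u @ [r..<n]) ` jones r j)"

fun admissible_prefixes :: "nat \<Rightarrow> (nat \<times> nat) list \<Rightarrow> nat list set" where
  "admissible_prefixes n [] = jones n n"
| "admissible_prefixes n [(t, j)] = ascending_tails n j"
| "admissible_prefixes n ((t, j) # x # xs) = jones n j"

text \<open>Induction on the start \<open>r\<close> of the ascending tail: either all earlier runs end below \<open>j\<close>, or the
  last of them is the single letter \<open>r - 1\<close> and extends the tail, or its end overlaps with the run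
  of the suffix.\<close>

lemma braid_free_single_block:
  assumes "1 \<le> j" "r \<le> n" "j \<le> r" "1 \<le> t" "u \<in> jones r r"
    and "braid_free n (u @ [r..<n] @ power_descending n t j)"
  shows "u @ [r..<n] \<in> ascending_tails n j"
  using assms(3,2,5,6)
proof (induction r arbitrary: u rule: dec_induct)
  case base
  then show ?case by (auto simp: ascending_tails_def)
next
  case (step r)
  show ?case
  proof (cases "u \<in> jones (Suc r) j")
    case True
    then show ?thesis using step by (auto simp: ascending_tails_def simp del: jones.simps)
  next
    case False
    with step.prems(2) obtain v p q where v: "u = v @ descending p q" "v \<in> jones p q"
      "1 \<le> q" "j \<le> q" "q \<le> p" "p < Suc r"
      by (rule jones_last_block)
    show ?thesis
    proof (cases "q = r")
      case True
      then have "p = r" using v by simp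
      then have "u = v @ descending r r" "v \<in> jones r r"
        using v(1,2) True by simp_all
      then have "u @ [Suc r..<n] = v @ [r..<n]" "v \<in> jones r r"
        using step.prems by (simp_all add: upt_conv_Cons[of r n] descending_snoc[of r r] descending_Nil)
      then show ?thesis using step.IH[of v] step.prems by (metis Suc_leD append_assoc)
    next
      case False
      have "\<not> braid_free n ([q] @ ([Suc r..<n] @ replicate t n) @ descending (n - 1) j)"
        using v False assms(1) step.prems by (intro descending_overlap) auto
      then show ?thesis
        using braid_free_factor[of n "v @ descending p (q + 1)"
            "[q] @ ([Suc r..<n] @ replicate t n) @ descending (n - 1) j" "[]"]
          step.prems(3) descending_snoc[of q p] v by (simp add: power_descending_def)
    qed
  qed
qed

lemma braid_free_imp_admissible:
  assumes "2 \<le> n" "p \<in> canonical_prefixes n" "xs \<in> suffix_data d n"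
    and "braid_free n (p @ suffix_word n xs)"
  shows "p \<in> admissible_prefixes n xs"
proof -
  have "braid_free n p" using braid_free_factor[of n "[]" p] assms by simp
  then have pj: "p \<in> jones n n" using braid_free_prefix[of n n p] assms by simp
  show ?thesis
  proof (cases "(n, xs)" rule: admissible_prefixes.cases)
    case (1 m)
    then show ?thesis using pj by simp
  next
    case (2 m t j)
    then show ?thesis
      using braid_free_single_block[of j n n t p] pj assms by (simp add: suffix_data_Cons)
  next
    case (3 m t j x ys)
    obtain t' j' where x: "x = (t', j')" by (cases x)
    have t: "1 \<le> t" "1 \<le> t'" and j: "1 \<le> j" "j < n"
      using assms(3) 3 by (auto simp: x suffix_data_Cons)
    have "p \<in> jones n j"
    proof (rule ccontr)
      assume "p \<notin> jones n j"
      with pj obtain u r q where u: "p = u @ descending r q" "1 \<le> q" "j \<le> q" "q \<le> r" "r < n"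
        by (rule jones_last_block)
      let ?z = "descending (n - 1) j' @ suffix_word n ys"
      have w: "p @ suffix_word n xs = (u @ descending r (q + 1)) @ [q] @ replicate t n @
          descending (n - 1) j @ replicate t' n @ ?z"
        using u 3 descending_snoc[of q r] by (simp add: x power_descending_def)
      \<comment> \<open>The letter \<open>q\<close> commutes with the letters \<open>n\<close> unless \<open>q = n - 1\<close>; in that case the second
        block makes a long move possible.\<close>
      show False
      proof (cases "q = n - 1")
        case True
        then show False
          using last_letter_overlap[of j n t t'] t j assms(4)
            braid_free_factor[of n "u @ descending r (q + 1)" _ ?z] unfolding w by simp
      next
        case False
        have "\<not> braid_free n ([q] @ replicate t n @ descending (n - 1) j)"
          using u False j by (intro descending_overlap) auto
        then show False
          using assms(4) braid_free_factor[of n "u @ descending r (q + 1)"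
            "[q] @ replicate t n @ descending (n - 1) j" "replicate t' n @ ?z"] unfolding w by simp
      qed
    qed
    then show ?thesis using 3 by simp
  qed
qed


section \<open>Canonical words that admit no braid move\<close>

text \<open>Commutations do not change the numbers of letters \<open>s\<^sub>i\<^sub>-\<^sub>1\<close> and \<open>s\<^sub>i\<^sub>+\<^sub>1\<close> between consecutive
  letters \<open>s\<^sub>i\<close>, while every braid move needs a pair of consecutive \<open>s\<^sub>i\<close> with exactly one such
  letter in between, or with only letters \<open>s\<^sub>n\<close> in between and a further \<open>s\<^sub>n\<close> outside.\<close>

definition first_gap :: "nat \<Rightarrow> nat list \<Rightarrow> nat \<times> nat" where
  "first_gap i v = (count_list (takeWhile ((\<noteq>) i) v) (i - 1), count_list (takeWhile ((\<noteq>) i) v) (i + 1))"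

fun gaps :: "nat \<Rightarrow> nat list \<Rightarrow> (nat \<times> nat) set" where
  "gaps i [] = {}"
| "gaps i (a # v) = (if a = i \<and> i \<in> set v then {first_gap i v} else {}) \<union> gaps i v"

lemma first_gap_swap:
  assumes "b + 1 < a \<or> a + 1 < b"
  shows "first_gap i (x @ a # b # z) = first_gap i (x @ b # a # z)"
  by (induction x) (use assms in \<open>auto simp: first_gap_def\<close>)

lemma gaps_swap:
  assumes "b + 1 < a \<or> a + 1 < b"
  shows "gaps i (x @ a # b # z) = gaps i (x @ b # a # z)"
proof (induction x)
  case Nil
  have "first_gap a (b # z) = first_gap a z" "first_gap b (a # z) = first_gap b z"
    using assms by (auto simp: first_gap_def)
  then show ?case using assms by auto
next
  case (Cons c x)
  have "i \<in> set (x @ a # b # z) \<longleftrightarrow> i \<in> set (x @ b # a # z)" by auto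
  then show ?case using Cons first_gap_swap[OF assms, of i x z] by (simp only: gaps.simps append_Cons)
qed

lemma gaps_member:
  assumes "i \<notin> set y"
  shows "(count_list y (i - 1), count_list y (i + 1)) \<in> gaps i (x @ i # y @ i # z)"
proof (induction x)
  case Nil
  have "takeWhile ((\<noteq>) i) (y @ i # z) = y"
    using assms by (subst takeWhile_append2) auto
  then show ?case by (simp add: first_gap_def)
qed simp

text \<open>The third alternative allows two letters \<open>s\<^sub>n\<^sub>-\<^sub>1\<close> that have all letters \<open>s\<^sub>n\<close> of the word
  between them; the parameter \<open>N\<close> is the number of these.\<close>

definition wide_gap :: "nat \<Rightarrow> nat \<Rightarrow> nat \<Rightarrow> nat \<times> nat \<Rightarrow> bool" where
  "wide_gap n N i g \<longleftrightarrow> (1 \<le> fst g \<and> 1 \<le> snd g) \<or> (i + 1 < n \<and> 2 \<le> snd g) \<or>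
     (i + 1 = n \<and> 1 \<le> snd g \<and> snd g = N)"

definition wide :: "nat \<Rightarrow> nat \<Rightarrow> nat list \<Rightarrow> bool" where
  "wide n N v \<longleftrightarrow> (\<forall>i\<in>{1..<n}. \<forall>g\<in>gaps i v. wide_gap n N i g)"

lemma wide_commutation:
  assumes "(u, v) \<in> commutation n" "wide n (count_list u n) u"
  shows "wide n (count_list v n) v"
proof -
  obtain x z a b where "u = x @ a # b # z" "v = x @ b # a # z" "b + 1 < a \<or> a + 1 < b"
    using assms(1) by (auto simp: commutation_def)
  then have "gaps i u = gaps i v" "count_list u n = count_list v n" for i
    using gaps_swap by simp_all
  then show ?thesis using assms(2) by (simp only: wide_def)
qed

lemma wide_comm_equiv:
  assumes "comm_equiv n u v" "wide n (count_list u n) u"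
  shows "wide n (count_list v n) v"
  using assms unfolding comm_equiv_def
  by (induction rule: rtrancl_induct) (auto dest: wide_commutation)

lemma count_list_replicate [simp]: "count_list (replicate k a) b = (if a = b then k else 0)"
  by (induction k) auto

lemma braid_move_not_wide:
  assumes "braid_move n u v"
  shows "\<not> wide n (count_list u n) u"
  using assms
proof (induction rule: braid_move.induct)
  case (short_up i x z)
  then have "(0, 1) \<in> gaps i (x @ [i, i + 1, i] @ z)"
    using gaps_member[of i "[i + 1]" x z] by (simp split: if_splits)
  then have "\<exists>g\<in>gaps i (x @ [i, i + 1, i] @ z). \<not> wide_gap n N i g" for N
    using short_up by (intro bexI[of _ "(0, 1)"]) (auto simp: wide_gap_def)
  then show ?case using short_up unfolding wide_def by fastforce
next
  case (short_down i x z)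
  then have "(1, 0) \<in> gaps (i + 1) (x @ [i + 1, i, i + 1] @ z)"
    using gaps_member[of "i + 1" "[i]" x z] by simp
  then have "\<exists>g\<in>gaps (i + 1) (x @ [i + 1, i, i + 1] @ z). \<not> wide_gap n N (i + 1) g" for N
    by (intro bexI[of _ "(1, 0)"]) (auto simp: wide_gap_def)
  then show ?case using short_down unfolding wide_def by fastforce
next
  case (long_left a b x z)
  then have y: "n - 1 \<notin> set (replicate b n)" "count_list (replicate b n) (n - 1 - 1) = 0"
    "count_list (replicate b n) (n - 1 + 1) = b"
    by auto
  let ?w = "x @ replicate a n @ [n - 1] @ replicate b n @ [n - 1] @ z"
  have "(0, b) \<in> gaps (n - 1) ?w"
    using gaps_member[OF y(1), of "x @ replicate a n" z] y(2,3) by simp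
  then have "\<exists>g\<in>gaps (n - 1) ?w. \<not> wide_gap n (count_list ?w n) (n - 1) g"
    using long_left by (intro bexI[of _ "(0, b)"]) (auto simp: wide_gap_def)
  then show ?case using long_left unfolding wide_def by fastforce
next
  case (long_right a b x z)
  then have y: "n - 1 \<notin> set (replicate b n)" "count_list (replicate b n) (n - 1 - 1) = 0"
    "count_list (replicate b n) (n - 1 + 1) = b"
    by auto
  let ?w = "x @ [n - 1] @ replicate b n @ [n - 1] @ replicate a n @ z"
  have "(0, b) \<in> gaps (n - 1) ?w"
    using gaps_member[OF y(1), of x "replicate a n @ z"] y(2,3) by simp
  then have "\<exists>g\<in>gaps (n - 1) ?w. \<not> wide_gap n (count_list ?w n) (n - 1) g"
    using long_right by (intro bexI[of _ "(0, b)"]) (auto simp: wide_gap_def)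
  then show ?case using long_right unfolding wide_def by fastforce
qed

lemma wide_imp_braid_free: "wide n (count_list u n) u \<Longrightarrow> braid_free n u"
  unfolding braid_free_def using wide_comm_equiv braid_move_not_wide by blast

lemma wide_Nil [simp]: "wide n N []"
  by (simp add: wide_def)

lemma wide_Cons:
  assumes "wide n N v" "a \<in> set v \<Longrightarrow> 1 \<le> a \<Longrightarrow> a < n \<Longrightarrow> wide_gap n N a (first_gap a v)"
  shows "wide n N (a # v)"
  using assms by (auto simp: wide_def)

lemma wide_replicate: "wide n N v \<Longrightarrow> wide n N (replicate k n @ v)"
  by (induction k) (auto intro: wide_Cons)

lemma count_list_pos: "a \<in> set v \<Longrightarrow> 1 \<le> count_list v a"
  by (metis One_nat_def Suc_leI count_list_0_iff gr0I)

lemma takeWhile_descending: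
  assumes "i \<notin> set x" "1 \<le> j" "j \<le> i" "i \<le> m"
  shows "takeWhile ((\<noteq>) i) (x @ descending m j @ v) = x @ descending m (i + 1)"
proof -
  have "descending m j = descending m (i + 1) @ i # descending (i - 1) j"
    using assms descending_split[of "i + 1" j m] descending_Cons[of j i] by simp
  then have "x @ descending m j @ v = (x @ descending m (i + 1)) @ i # descending (i - 1) j @ v"
    by simp
  moreover have "takeWhile ((\<noteq>) i) ((x @ descending m (i + 1)) @ i # descending (i - 1) j @ v) =
      x @ descending m (i + 1)"
    using assms by (subst takeWhile_append2) auto
  ultimately show ?thesis by simp
qed

text \<open>Between a letter \<open>i\<close> of the run and the first \<open>i\<close> of \<open>v\<close>, the letter \<open>i - 1\<close> is supplied by the
  run, which continues below \<open>i\<close>, and the letter \<open>i + 1\<close> by \<open>v\<close>.\<close>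

lemma wide_descending:
  assumes "wide n N v" "m < n" "1 \<le> j"
    and "\<And>i. i \<in> set v \<Longrightarrow> j \<le> i \<Longrightarrow> i \<le> m \<Longrightarrow> j < i \<and> i + 1 \<in> set (takeWhile ((\<noteq>) i) v)"
  shows "wide n N (descending m j @ v)"
  using assms(2,4)
proof (induction m)
  case 0
  then show ?case using assms by (simp add: descending_Nil)
next
  case (Suc m)
  show ?case
  proof (cases "j \<le> Suc m")
    case True
    have "wide n N (Suc m # descending m j @ v)"
    proof (rule wide_Cons)
      show "wide n N (descending m j @ v)" using Suc by simp
      assume "Suc m \<in> set (descending m j @ v)"
      then have v: "j < Suc m" "Suc m + 1 \<in> set (takeWhile ((\<noteq>) (Suc m)) v)"
        using Suc.prems(2)[of "Suc m"] True by auto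
      have "takeWhile ((\<noteq>) (Suc m)) (descending m j @ v) =
          descending m j @ takeWhile ((\<noteq>) (Suc m)) v"
        by (subst takeWhile_append2) auto
      then show "wide_gap n N (Suc m) (first_gap (Suc m) (descending m j @ v))"
        using v count_list_pos[OF v(2)] count_list_pos[of m "descending m j"]
        by (simp add: wide_gap_def first_gap_def)
    qed
    then show ?thesis using descending_Cons[OF assms(3) True] by simp
  next
    case False
    then show ?thesis using assms(1) by (simp add: descending_Nil)
  qed
qed

text \<open>The condition under which a word \<open>v\<close> may follow descending runs that start below \<open>r\<close> and end
  below \<open>j\<close>.\<close>

definition guarded :: "nat \<Rightarrow> nat \<Rightarrow> nat list \<Rightarrow> bool" where
  "guarded r j v \<longleftrightarrow> (\<forall>i\<in>set v. i < r \<longrightarrow> j \<le> i \<and> i + 1 \<in> set (takeWhile ((\<noteq>) i) v))"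

text \<open>Adding the runs from the last to the first, each of them guards the word for the runs before
  it.\<close>

lemma wide_jones:
  assumes "u \<in> jones r j" "r \<le> n" "wide n N v" "guarded r j v"
  shows "wide n N (u @ v)"
  using assms
proof (induction r arbitrary: u j v)
  case (Suc r)
  show ?case
  proof (cases "u \<in> jones r j")
    case True
    then show ?thesis using Suc by (simp add: guarded_def)
  next
    case False
    then obtain q u' where u: "u = u' @ descending r q" "u' \<in> jones r q" "1 \<le> q" "q < j" "q \<le> r"
      using Suc.prems(1) by auto
    have "wide n N (descending r q @ v)"
      using Suc.prems u by (intro wide_descending) (auto simp: guarded_def)
    moreover have "guarded r q (descending r q @ v)"
      unfolding guarded_def
    proof (intro ballI impI)
      fix i assume i: "i \<in> set (descending r q @ v)" "i < r"
      then have "q \<le> i" using Suc.prems(4) u by (fastforce simp: guarded_def)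
      then show "q \<le> i \<and> i + 1 \<in> set (takeWhile ((\<noteq>) i) (descending r q @ v))"
        using takeWhile_descending[of i "[]" q r v] u i by simp
    qed
    ultimately have "wide n N (u' @ descending r q @ v)"
      using Suc.IH u Suc.prems(2) by simp
    then show ?thesis by (simp add: u)
  qed
qed simp

lemma guarded_suffix:
  assumes "xs \<in> suffix_data d n" "\<And>j'. j' \<in> snd ` set xs \<Longrightarrow> j \<le> j'"
  shows "guarded n j (suffix_word n xs)"
  using assms
proof (induction xs arbitrary: j)
  case (Cons x xs)
  obtain k m where x: "x = (k, m)" by (cases x)
  have xs: "xs \<in> suffix_data d n" "\<And>j'. j' \<in> snd ` set xs \<Longrightarrow> m + 1 \<le> j'" and k: "1 \<le> k"
    and m: "1 \<le> m" "m \<le> n" "j \<le> m"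
    using Cons.prems by (auto simp: x suffix_data_Cons)
  show ?case
    unfolding guarded_def
  proof (intro ballI impI)
    fix i assume i: "i \<in> set (suffix_word n (x # xs))" "i < n"
    have "m \<le> i"
      using i Cons.IH[OF xs] by (auto simp: x guarded_def power_descending_def)
    then have "takeWhile ((\<noteq>) i) (suffix_word n (x # xs)) = replicate k n @ descending (n - 1) (i + 1)"
      using takeWhile_descending[of i "replicate k n" m "n - 1" "suffix_word n xs"] i m
      by (simp add: x power_descending_def)
    moreover have "i + 1 \<in> set (replicate k n @ descending (n - 1) (i + 1))"
      using i k by auto
    ultimately show "j \<le> i \<and> i + 1 \<in> set (takeWhile ((\<noteq>) i) (suffix_word n (x # xs)))"
      using m \<open>m \<le> i\<close> by simp
  qed
qed (simp add: guarded_def)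

lemma wide_suffix:
  assumes "xs \<in> suffix_data d n"
  shows "wide n N (suffix_word n xs)"
  using assms
proof (induction xs)
  case (Cons x xs)
  obtain k m where x: "x = (k, m)" by (cases x)
  have xs: "xs \<in> suffix_data d n" "\<And>j'. j' \<in> snd ` set xs \<Longrightarrow> m + 1 \<le> j'" and m: "1 \<le> m" "m \<le> n"
    using Cons.prems by (auto simp: x suffix_data_Cons)
  have "wide n N (descending (n - 1) m @ suffix_word n xs)"
    using Cons.IH[OF xs(1)] m guarded_suffix[OF xs]
    by (intro wide_descending) (auto simp: guarded_def)
  then show ?case using wide_replicate by (simp add: x power_descending_def)
qed simp

lemma takeWhile_tail:
  assumes "i \<notin> set x" "1 \<le> j" "j \<le> i" "i < n"
  shows "takeWhile ((\<noteq>) i) (x @ power_descending n t j) = x @ replicate t n @ descending (n - 1) (i + 1)"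
  using takeWhile_descending[of i "x @ replicate t n" j "n - 1" "[]"] assms
  by (auto simp: power_descending_def)

lemma wide_ascending_tail:
  assumes "1 \<le> j" "j \<le> r" "r \<le> n" "1 \<le> t"
  shows "wide n t ([r..<n] @ power_descending n t j)"
  using assms(3,2)
proof (induction rule: inc_induct)
  case base
  have "wide n t (descending (n - 1) j @ [])"
    using assms by (intro wide_descending) auto
  then show ?case using wide_replicate by (simp add: power_descending_def)
next
  case (step r)
  have tw: "takeWhile ((\<noteq>) r) ([Suc r..<n] @ power_descending n t j) =
      [Suc r..<n] @ replicate t n @ descending (n - 1) (r + 1)"
    using takeWhile_tail[of r "[Suc r..<n]" j n t] step assms by simp
  have "wide_gap n t r (first_gap r ([Suc r..<n] @ power_descending n t j))"
  proof (cases "r + 1 = n")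
    case True
    then show ?thesis using assms unfolding first_gap_def tw by (simp add: wide_gap_def descending_Nil)
  next
    case False
    then have "r + 1 \<in> set [Suc r..<n]" "r + 1 \<in> set (descending (n - 1) (r + 1))"
      using step.hyps by auto
    note this[THEN count_list_pos]
    then show ?thesis using False step.hyps unfolding first_gap_def tw by (simp add: wide_gap_def)
  qed
  then have "wide n t (r # [Suc r..<n] @ power_descending n t j)"
    using step by (intro wide_Cons) auto
  then show ?case using step.hyps by (simp add: upt_conv_Cons)
qed

lemma guarded_ascending_tail:
  assumes "1 \<le> j" "j \<le> r" "r \<le> n" "1 \<le> t"
  shows "guarded r j ([r..<n] @ power_descending n t j)"
  unfolding guarded_def
proof (intro ballI impI)
  fix i assume i: "i \<in> set ([r..<n] @ power_descending n t j)" "i < r"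
  then have "j \<le> i" using assms by (auto simp: power_descending_def)
  moreover have "i + 1 \<in> set (replicate t n @ descending (n - 1) (i + 1))" using i assms by auto
  ultimately show "j \<le> i \<and> i + 1 \<in> set (takeWhile ((\<noteq>) i) ([r..<n] @ power_descending n t j))"
    using takeWhile_tail[of i "[r..<n]" j n t] i assms by auto
qed

lemma admissible_imp_braid_free:
  assumes "xs \<in> suffix_data d n" "p \<in> admissible_prefixes n xs"
  shows "braid_free n (p @ suffix_word n xs)"
proof -
  have sorted: "braid_free n (p @ suffix_word n xs)"
    if "p \<in> jones n j" "\<And>j'. j' \<in> snd ` set xs \<Longrightarrow> j \<le> j'" for j
    using that wide_jones[of p n j n] wide_suffix[OF assms(1)] guarded_suffix[OF assms(1)]
    by (intro wide_imp_braid_free) blast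
  show ?thesis
  proof (cases "(n, xs)" rule: admissible_prefixes.cases)
    case (1 m)
    then show ?thesis using sorted[of n] assms(2) by simp
  next
    case (2 m t j)
    then obtain r u where r: "j \<le> r" "r \<le> n" and p: "p = u @ [r..<n]" "u \<in> jones r j"
      using assms(2) by (auto simp: ascending_tails_def)
    have j: "1 \<le> j" "1 \<le> t" using assms(1) 2 by (auto simp: suffix_data_Cons)
    have "count_list p n = 0"
      using jones_letters[OF p(2)] r by (auto simp: p count_list_0_iff)
    then have "count_list (p @ suffix_word n xs) n = t"
      using 2 j by (auto simp: power_descending_def count_list_0_iff)
    moreover have "wide n t (u @ [r..<n] @ power_descending n t j)"
      using wide_jones[OF p(2) r(2)] wide_ascending_tail guarded_ascending_tail r j by blast
    ultimately show ?thesis using 2 p by (intro wide_imp_braid_free) simp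
  next
    case (3 m t j x ys)
    then have "j \<le> j'" if "j' \<in> snd ` set xs" for j'
      using assms(1) that by (cases x) (auto simp: suffix_data_Cons)
    then show ?thesis using sorted[of j] assms(2) 3 by simp
  qed
qed

lemma ascending_tails_subset_jones:
  assumes "1 \<le> j"
  shows "ascending_tails n j \<subseteq> jones n n"
proof -
  have "u @ [r..<n] \<in> jones n n" if "j \<le> r" "r \<le> n" "u \<in> jones r j" for u r
    using that(2)
  proof (induction rule: dec_induct)
    case base
    then show ?case using jones_mono_end[OF that(1)] that(3) by auto
  next
    case (step m)
    have "u @ [r..<Suc m] = (u @ [r..<m]) @ descending m m"
      using step.hyps by (simp add: descending_snoc descending_Nil)
    moreover have "(u @ [r..<m]) @ descending m m \<in> jones (Suc m) (Suc m)"
      unfolding jones.simps using step that(1) assms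
      by (intro UnI2 UN_I[of m] imageI[of _ _ "\<lambda>u. u @ descending m m"]) auto
    ultimately show ?case by simp
  qed
  then show ?thesis by (auto simp: ascending_tails_def)
qed

lemma admissible_prefixes_subset:
  assumes "1 \<le> n" "xs \<in> suffix_data d n"
  shows "admissible_prefixes n xs \<subseteq> canonical_prefixes n"
proof (cases "(n, xs)" rule: admissible_prefixes.cases)
  case (2 m t j)
  then show ?thesis
    using assms(2) ascending_tails_subset_jones[of j n] jones_subset_canonical[OF assms(1)]
    by (auto simp: suffix_data_Cons)
qed (use jones_subset_canonical[OF assms(1)] in auto)


section \<open>Counting admissible prefixes\<close>

lemma catalan_triangle_0: "catalan_triangle n 0 = 1"
  by (simp add: catalan_triangle_def)

lemma catalan_triangle_above: "catalan_triangle n (n + 1) = 0"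
  by (simp add: catalan_triangle_def)

text \<open>The recursion of the Catalan triangle. It extends to the diagonal because the formula gives \<open>0\<close>
  for \<open>k = n + 1\<close>.\<close>

lemma catalan_triangle_Suc:
  "catalan_triangle (Suc n) (Suc k) = catalan_triangle (Suc n) k + catalan_triangle n (Suc k)"
proof -
  have "(fact (Suc n + Suc k) :: real) = (real n + real k + 2) * (real n + real k + 1) * fact (n + k)"
    "(fact (Suc n + k) :: real) = (real n + real k + 1) * fact (n + k)"
    "(fact (n + Suc k) :: real) = (real n + real k + 1) * fact (n + k)"
    "(fact (Suc k) :: real) = (real k + 1) * fact k"
    "(fact (Suc n + 1) :: real) = (real n + 2) * fact (n + 1)"
    by (simp_all add: algebra_simps)
  moreover have "(fact (n + 1) :: real) > 0" "(fact k :: real) > 0" "(fact (n + k) :: real) > 0"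
    "real n + 2 > 0" "real k + 1 > 0" by simp_all
  ultimately show ?thesis
    unfolding catalan_triangle_def
    by (simp del: fact_Suc add: divide_simps) (simp add: algebra_simps)
qed

lemma catalan_triangle_row_sum: "catalan_triangle (Suc n) k = (\<Sum>s\<le>k. catalan_triangle n s)"
  by (induction k) (simp_all add: catalan_triangle_0 catalan_triangle_Suc)

lemma catalan_triangle_diagonal: "catalan_triangle (Suc n) (Suc n) = catalan_triangle (Suc n) n"
  using catalan_triangle_Suc[of n n] catalan_triangle_above[of n] by simp

lemma catalan_triangle_column_sum:
  assumes "1 \<le> j" "j \<le> n"
  shows "(\<Sum>r = j..n. catalan_triangle r (j - 1)) = catalan_triangle n j"
  using assms(2)
proof (induction n rule: dec_induct)
  case base
  show ?case using assms(1) catalan_triangle_diagonal[of "j - 1"] by simp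
next
  case (step n)
  then show ?case using assms(1) catalan_triangle_Suc[of n "j - 1"] by simp
qed

lemma catalan_triangle_catalan: "catalan_triangle n n = catalan n"
proof -
  have "real ((2 * n) choose n) = fact (2 * n) / (fact n * fact n)"
    using binomial_fact[of n "2 * n", where 'a = real] by simp
  then show ?thesis
    by (simp add: catalan_triangle_def catalan_def mult_2)
qed

lemma finite_jones [simp]: "finite (jones r j)"
  by (induction r arbitrary: j) auto

lemma last_descending: "q \<le> r \<Longrightarrow> last (u @ descending r q) = q"
  using descending_snoc[of q r] by simp

text \<open>Split by the end \<open>q\<close> of the run that starts at \<open>r\<close>, if there is one; \<open>q\<close> is the last letter of
  the word.\<close>

lemma card_jones_Suc:
  "card (jones (Suc r) j) = card (jones r j) + (\<Sum>q\<in>{1..<j} \<inter> {..r}. card (jones r q))"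
proof -
  let ?A = "\<lambda>q. (\<lambda>u. u @ descending r q) ` jones r q"
  have "card (\<Union>q\<in>{1..<j} \<inter> {..r}. ?A q) = (\<Sum>q\<in>{1..<j} \<inter> {..r}. card (?A q))"
  proof (rule card_UN_disjoint)
    show "\<forall>q\<in>{1..<j} \<inter> {..r}. \<forall>q'\<in>{1..<j} \<inter> {..r}. q \<noteq> q' \<longrightarrow> ?A q \<inter> ?A q' = {}"
    proof (intro ballI impI)
      fix q q' assume "q \<in> {1..<j} \<inter> {..r}" "q' \<in> {1..<j} \<inter> {..r}" "q \<noteq> q'"
      then have "\<forall>w\<in>?A q. last w = q" "\<forall>w\<in>?A q'. last w = q'"
        using last_descending by auto
      then show "?A q \<inter> ?A q' = {}" using \<open>q \<noteq> q'\<close> by (metis disjoint_iff)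
    qed
  qed auto
  also have "\<dots> = (\<Sum>q\<in>{1..<j} \<inter> {..r}. card (jones r q))"
    by (intro sum.cong HOL.refl card_image) (simp_all add: inj_on_def)
  finally have "card (\<Union>q\<in>{1..<j} \<inter> {..r}. ?A q) = \<dots>" .
  moreover have "jones r j \<inter> (\<Union>q\<in>{1..<j} \<inter> {..r}. ?A q) = {}"
  proof -
    have "r \<in> set (u @ descending r q)" if "q \<le> r" for u q
      using that by simp
    then show ?thesis using jones_letters[of _ r j] by fastforce
  qed
  ultimately show ?thesis by (simp add: card_Un_disjoint)
qed

text \<open>The recurrence just proved is the row sum of the Catalan triangle.\<close>

lemma card_jones:
  assumes "1 \<le> j" "j \<le> r + 1"
  shows "real (card (jones r j)) = catalan_triangle r (j - 1)"
  using assms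
proof (induction r arbitrary: j)
  case 0
  then show ?case by (simp add: catalan_triangle_0)
next
  case (Suc r)
  have small: "real (card (jones (Suc r) j)) = catalan_triangle (Suc r) (j - 1)"
    if j: "1 \<le> j" "j \<le> r + 1" for j
  proof -
    have eq: "{1..<j} \<inter> {..r} = {1..<j}" using j by auto
    have "real (card (jones (Suc r) j)) = (\<Sum>q\<in>{1..<Suc j}. real (card (jones r q)))"
      using j unfolding card_jones_Suc eq by simp
    also have "\<dots> = (\<Sum>q\<in>{1..<Suc j}. catalan_triangle r (q - 1))"
      using Suc.IH j by (intro sum.cong HOL.refl) auto
    also have "\<dots> = (\<Sum>s<j. catalan_triangle r s)"
      unfolding One_nat_def sum.shift_bounds_Suc_ivl by (simp add: atLeast0LessThan)
    also have "\<dots> = catalan_triangle (Suc r) (j - 1)"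
      using j by (simp add: catalan_triangle_row_sum lessThan_Suc_atMost[symmetric])
    finally show ?thesis .
  qed
  show ?case
  proof (cases "j \<le> r + 1")
    case False
    then have "j = Suc r + 1" using Suc.prems by simp
    then show ?thesis
      using small[of "r + 1"] jones_saturated[of "Suc r" "Suc r + 1"] catalan_triangle_diagonal[of r]
      by simp
  qed (use small Suc.prems in simp)
qed

lemma finite_ascending_tails [simp]: "finite (ascending_tails n j)"
  by (auto simp: ascending_tails_def)

text \<open>The start of the tail is determined by the word: if a word had tails starting at \<open>r < m\<close>, then
  \<open>m - 1 \<ge> j\<close> would be the last letter of a word in \<open>jones m j\<close>. The sum over \<open>r\<close> is a column sum of the Catalan triangle.\<close>

lemma card_ascending_tails:
  assumes "1 \<le> j" "j \<le> n"
  shows "real (card (ascending_tails n j)) = catalan_triangle n j"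
proof -
  let ?A = "\<lambda>r. (\<lambda>u. u @ [r..<n]) ` jones r j"
  have disj: "?A r \<inter> ?A m = {}" if rm: "j \<le> r" "r < m" "m \<le> n" for r m
  proof (rule ccontr)
    assume "?A r \<inter> ?A m \<noteq> {}"
    then obtain u v where uv: "v \<in> jones m j" "u @ [r..<n] = v @ [m..<n]" by auto
    moreover have "[r..<n] = [r..<m] @ [m..<n]"
      using rm upt_add_eq_append[of r m "n - m"] by simp
    ultimately have v: "v = u @ [r..<m]" by simp
    then have "last v = m - 1" "v \<noteq> []" using rm by (auto simp: last_upt)
    then show False using jones_last[OF uv(1)] rm by simp
  qed
  have "card (ascending_tails n j) = (\<Sum>r\<in>{j..n}. card (?A r))"
    unfolding ascending_tails_def
  proof (rule card_UN_disjoint)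
    show "\<forall>r\<in>{j..n}. \<forall>m\<in>{j..n}. r \<noteq> m \<longrightarrow> ?A r \<inter> ?A m = {}"
    proof (intro ballI impI)
      fix r m assume "r \<in> {j..n}" "m \<in> {j..n}" "r \<noteq> m"
      then show "?A r \<inter> ?A m = {}"
        using disj[of r m] disj[of m r] by (cases r m rule: linorder_cases) auto
    qed
  qed auto
  also have "\<dots> = (\<Sum>r\<in>{j..n}. card (jones r j))"
    by (intro sum.cong HOL.refl card_image) (simp_all add: inj_on_def)
  finally have "real (card (ascending_tails n j)) = (\<Sum>r = j..n. catalan_triangle r (j - 1))"
    using card_jones assms by simp
  then show ?thesis using catalan_triangle_column_sum[OF assms] by simp
qed

text \<open>For a single block, the minimum puts both \<open>s\<^sub>n\<^sup>t\<close> and \<open>s\<^sub>n\<^sup>t s\<^sub>n\<^sub>-\<^sub>1\<close> into the packet \<open>n - 1\<close>.\<close>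

fun packet_index :: "nat \<Rightarrow> (nat \<times> nat) list \<Rightarrow> nat" where
  "packet_index n [] = n"
| "packet_index n [(t, j)] = min j (n - 1)"
| "packet_index n ((t, j) # x # xs) = j - 1"

lemma card_admissible_prefixes:
  assumes "1 \<le> n" "xs \<in> suffix_data d n"
  shows "real (card (admissible_prefixes n xs)) = catalan_triangle n (packet_index n xs)"
proof -
  have diag: "catalan_triangle n (n - 1) = catalan_triangle n n"
    using catalan_triangle_diagonal[of "n - 1"] assms(1) by simp
  show ?thesis
  proof (cases "(n, xs)" rule: admissible_prefixes.cases)
    case (1 m)
    then show ?thesis using card_jones[of n n] assms(1) diag by simp
  next
    case (2 m t j)
    then have "1 \<le> j" "j \<le> n" using assms(2) by (auto simp: suffix_data_Cons)
    then show ?thesis using card_ascending_tails[of j n] 2 diag by (cases "j = n") auto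
  next
    case (3 m t j x ys)
    then have "1 \<le> j" "j \<le> n" using assms(2) by (auto simp: suffix_data_Cons)
    then show ?thesis using card_jones[of j n] 3 by simp
  qed
qed

lemma finite_admissible_prefixes [simp]: "finite (admissible_prefixes n xs)"
  by (cases "(n, xs)" rule: admissible_prefixes.cases) auto

lemma Nil_in_admissible_prefixes:
  assumes "xs \<in> suffix_data d n"
  shows "[] \<in> admissible_prefixes n xs"
proof (cases "(n, xs)" rule: admissible_prefixes.cases)
  case (2 m t j)
  then have "j \<le> n" using assms by (auto simp: suffix_data_Cons)
  then show ?thesis using 2 by (force simp: ascending_tails_def intro!: bexI[of _ n])
qed auto


section \<open>Collections and packets\<close>

lemma canonical_decomposition_unique:
  assumes "1 \<le> d" "1 \<le> n" "p \<in> canonical_prefixes n" "p' \<in> canonical_prefixes n"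
    "xs \<in> suffix_data d n" "xs' \<in> suffix_data d n" "p @ suffix_word n xs = p' @ suffix_word n xs'"
  shows "p = p' \<and> xs = xs'"
proof (rule canonical_word_unique[OF assms(1-6)])
  have "p @ suffix_word n xs \<in> lists {1..n}"
    using assms by (intro canonical_word_letters[of _ d]) (auto simp: canonical_words_def)
  then show "same_element d n (p @ suffix_word n xs) (p' @ suffix_word n xs')"
    using assms(7) same_element_refl by simp
qed

lemma fully_commutative_iff_admissible:
  assumes "1 \<le> d" "2 \<le> n" "p \<in> canonical_prefixes n" "xs \<in> suffix_data d n"
  shows "fully_commutative d n (word_elem d n (p @ suffix_word n xs)) \<longleftrightarrow> p \<in> admissible_prefixes n xs"
proof -
  have "p @ suffix_word n xs \<in> canonical_words d n"
    using assms by (auto simp: canonical_words_def)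
  then have "fully_commutative d n (word_elem d n (p @ suffix_word n xs)) \<longleftrightarrow>
      braid_free n (p @ suffix_word n xs)"
    using fully_commutative_iff_braid_free assms by simp
  then show ?thesis
    using braid_free_imp_admissible[OF assms(2-4)] admissible_imp_braid_free[OF assms(4)] by blast
qed

lemma collection_eq:
  assumes "1 \<le> d" "2 \<le> n" "xs \<in> suffix_data d n"
  shows "collection d n (suffix_word n xs) = (\<lambda>p. p @ suffix_word n xs) ` admissible_prefixes n xs"
proof -
  have "p @ suffix_word n xs \<in> collection d n (suffix_word n xs) \<longleftrightarrow> p \<in> admissible_prefixes n xs"
    if "p \<in> canonical_prefixes n" for p
    using fully_commutative_iff_admissible[OF assms(1,2) that assms(3)] that assms(3)
    by (auto simp: collection_def canonical_words_def)
  moreover have "admissible_prefixes n xs \<subseteq> canonical_prefixes n"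
    using admissible_prefixes_subset assms by simp
  ultimately show ?thesis by (auto simp: collection_def)
qed

text \<open>Every collection contains its own suffix as a word with empty prefix, so different suffixes give
  different collections.\<close>

lemma collection_inj:
  assumes "1 \<le> d" "2 \<le> n"
  shows "inj_on (\<lambda>xs. collection d n (suffix_word n xs)) (suffix_data d n)"
proof (rule inj_onI)
  fix xs ys assume xs: "xs \<in> suffix_data d n" and ys: "ys \<in> suffix_data d n"
    and eq: "collection d n (suffix_word n xs) = collection d n (suffix_word n ys)"
  have "suffix_word n xs \<in> collection d n (suffix_word n ys)"
    using Nil_in_admissible_prefixes[OF xs] unfolding eq[symmetric] collection_eq[OF assms xs] by force
  then obtain p where "p \<in> canonical_prefixes n" "[] @ suffix_word n xs = p @ suffix_word n ys"
    unfolding collection_eq[OF assms ys] using admissible_prefixes_subset[OF _ ys] assms by auto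
  then show "xs = ys"
    using canonical_decomposition_unique[OF assms(1) _ Nil_in_canonical_prefixes _ xs ys] assms by auto
qed

lemma finite_suffix_data: "finite (suffix_data d n)"
proof -
  have "suffix_data d n \<subseteq> {xs. set xs \<subseteq> {1..d - 1} \<times> {1..n} \<and> length xs \<le> n}"
  proof
    fix xs assume xs: "xs \<in> suffix_data d n"
    then have "distinct (map snd xs)" "set (map snd xs) \<subseteq> {1..n}"
      by (auto simp: suffix_data_def strict_sorted_iff)
    then have "length xs \<le> card {1..n}"
      using card_mono[of "{1..n}" "set (map snd xs)"] distinct_card[of "map snd xs"] by simp
    then show "xs \<in> {xs. set xs \<subseteq> {1..d - 1} \<times> {1..n} \<and> length xs \<le> n}"
      using xs by (auto simp: suffix_data_def)
  qed
  then show ?thesis using finite_lists_length_le[of "{1..d - 1} \<times> {1..n}" n] finite_subset by blast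
qed

lemma card_fully_commutative:
  assumes "1 \<le> d" "2 \<le> n"
  shows "real (card {g \<in> carrier (reflection_group d n). fully_commutative d n g}) =
    (\<Sum>xs\<in>suffix_data d n. catalan_triangle n (packet_index n xs))"
proof -
  have n: "1 \<le> n" using assms by simp
  let ?C = "\<lambda>xs. (\<lambda>p. p @ suffix_word n xs) ` admissible_prefixes n xs"
  have adm: "p \<in> canonical_prefixes n" if "p \<in> admissible_prefixes n xs" "xs \<in> suffix_data d n" for p xs
    using that admissible_prefixes_subset[OF n] by blast
  have sub: "(\<Union>xs\<in>suffix_data d n. ?C xs) \<subseteq> canonical_words d n"
    using adm by (auto simp: canonical_words_def)
  have "{g \<in> carrier (reflection_group d n). fully_commutative d n g} =
      word_elem d n ` {w \<in> canonical_words d n. fully_commutative d n (word_elem d n w)}"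
    unfolding carrier_canonical[OF assms(1) n] by auto
  also have "{w \<in> canonical_words d n. fully_commutative d n (word_elem d n w)} =
      (\<Union>xs\<in>suffix_data d n. ?C xs)"
  proof
    show "{w \<in> canonical_words d n. fully_commutative d n (word_elem d n w)} \<subseteq>
        (\<Union>xs\<in>suffix_data d n. ?C xs)"
      using fully_commutative_iff_admissible[OF assms] by (auto simp: canonical_words_def)
    show "(\<Union>xs\<in>suffix_data d n. ?C xs) \<subseteq>
        {w \<in> canonical_words d n. fully_commutative d n (word_elem d n w)}"
      using fully_commutative_iff_admissible[OF assms] adm sub by blast
  qed
  finally have "card {g \<in> carrier (reflection_group d n). fully_commutative d n g} =
      card (\<Union>xs\<in>suffix_data d n. ?C xs)"
    using card_image[OF inj_on_subset[OF word_elem_canonical_inj[OF assms(1) n] sub]] by simp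
  also have "\<dots> = (\<Sum>xs\<in>suffix_data d n. card (?C xs))"
  proof (rule card_UN_disjoint[OF finite_suffix_data])
    show "\<forall>xs\<in>suffix_data d n. \<forall>ys\<in>suffix_data d n. xs \<noteq> ys \<longrightarrow> ?C xs \<inter> ?C ys = {}"
      using canonical_decomposition_unique[OF assms(1) n] adm by blast
  qed simp
  also have "\<dots> = (\<Sum>xs\<in>suffix_data d n. card (admissible_prefixes n xs))"
    by (intro sum.cong HOL.refl card_image) (simp_all add: inj_on_def)
  finally show ?thesis using card_admissible_prefixes[OF n] by simp
qed

definition single_blocks :: "nat \<Rightarrow> nat \<Rightarrow> (nat \<times> nat) list set" where
  "single_blocks d j = (\<lambda>t. [(t, j)]) ` {1..d - 1}"

definition several_blocks :: "nat \<Rightarrow> nat \<Rightarrow> nat \<Rightarrow> (nat \<times> nat) list set" where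
  "several_blocks d n j = {xs \<in> suffix_data d n. 2 \<le> length xs \<and> snd (hd xs) = j}"

lemma packet_index_fibre:
  assumes "3 \<le> n" "k \<le> n"
  shows "{xs \<in> suffix_data d n. packet_index n xs = k} =
    (if k = n then {[]} else if k = n - 1 then single_blocks d n \<union> single_blocks d (n - 1)
     else (if k = 0 then {} else single_blocks d k) \<union> several_blocks d n (k + 1))" (is "?L = ?R")
proof -
  have "xs \<in> ?L \<longleftrightarrow> xs \<in> ?R" for xs
  proof (cases "(n, xs)" rule: packet_index.cases)
    case (1 m)
    then show ?thesis using assms by (auto simp: single_blocks_def several_blocks_def)
  next
    case (2 m t j)
    have "xs \<in> single_blocks d i \<longleftrightarrow> 1 \<le> t \<and> t \<le> d - 1 \<and> i = j" for i
      using 2 by (auto simp: single_blocks_def)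
    moreover have "xs \<notin> several_blocks d n i" for i
      using 2 by (simp add: several_blocks_def)
    moreover have "xs \<in> ?L \<longleftrightarrow> 1 \<le> t \<and> t \<le> d - 1 \<and> 1 \<le> j \<and> j \<le> n \<and> min j (n - 1) = k"
      using 2 by (auto simp: suffix_data_Cons)
    ultimately show ?thesis using assms 2 by (auto simp: min_def)
  next
    case (3 m t j x ys)
    have "xs \<notin> single_blocks d i" for i using 3 by (auto simp: single_blocks_def)
    moreover have "j < n" "1 \<le> j" if "xs \<in> suffix_data d n"
      using 3 that by (cases x; auto simp: suffix_data_Cons)+
    moreover have "xs \<in> several_blocks d n i \<longleftrightarrow> xs \<in> suffix_data d n \<and> j = i" for i
      using 3 by (auto simp: several_blocks_def)
    ultimately show ?thesis using assms 3 by auto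
  qed
  then show ?thesis by blast
qed

lemma packet_labels_eq:
  assumes "3 \<le> n" "k \<le> n"
  shows "packet_labels d n k = suffix_word n ` {xs \<in> suffix_data d n. packet_index n xs = k}"
proof -
  have single: "suffix_word n ` single_blocks d j = {power_descending n t j | t. 1 \<le> t \<and> t \<le> d - 1}" for j
    by (force simp: single_blocks_def image_def)
  have "power_descending n t n = replicate t n" for t
    using assms by (simp add: power_descending_def descending_Nil)
  then have last: "suffix_word n ` single_blocks d n = {replicate t n | t. 1 \<le> t \<and> t \<le> d - 1}"
    using single[of n] by simp
  have several: "suffix_word n ` several_blocks d n j =
      {suffix_word n xs | xs. xs \<in> suffix_data d n \<and> 2 \<le> length xs \<and> snd (hd xs) = j}" for j
    by (auto simp: several_blocks_def)
  consider "k = 0" | "1 \<le> k" "k \<le> n - 2" | "k = n - 1" | "k = n" using assms by linarith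
  then show ?thesis
  proof cases
    case 2
    then have "k \<noteq> n" "k \<noteq> n - 1" "k \<noteq> 0" using assms by linarith+
    then show ?thesis unfolding packet_index_fibre[OF assms] packet_labels_def
      using 2 by (simp add: image_Un single[of k] several)
  next
    case 1
    then show ?thesis unfolding packet_index_fibre[OF assms] packet_labels_def
      using assms by (simp add: several)
  next
    case 3
    then have "k \<noteq> n" "\<not> k \<le> n - 2" "k \<noteq> 0" using assms by linarith+
    then show ?thesis unfolding packet_index_fibre[OF assms] packet_labels_def
      using 3 by (simp add: image_Un single[of "n - Suc 0"] last)
  next
    case 4
    then have "k \<noteq> n - 1" "\<not> k \<le> n - 2" "k \<noteq> 0" using assms by linarith+
    then show ?thesis unfolding packet_index_fibre[OF assms] packet_labels_def
      using 4 by simp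
  qed
qed

lemma card_packet:
  assumes "1 \<le> d" "3 \<le> n" "k \<le> n"
  shows "card (packet d n k) = card {xs \<in> suffix_data d n. packet_index n xs = k}"
proof -
  have "packet d n k = (\<lambda>xs. collection d n (suffix_word n xs)) `
      {xs \<in> suffix_data d n. packet_index n xs = k}"
    unfolding packet_def packet_labels_eq[OF assms(2,3)] by (simp add: image_image)
  moreover have "inj_on (\<lambda>xs. collection d n (suffix_word n xs))
      {xs \<in> suffix_data d n. packet_index n xs = k}"
    using inj_on_subset[OF collection_inj] assms by auto
  ultimately show ?thesis by (simp add: card_image)
qed

lemma packet_index_le: "xs \<in> suffix_data d n \<Longrightarrow> packet_index n xs \<le> n"
  by (cases "(n, xs)" rule: packet_index.cases) (auto simp: suffix_data_Cons)

lemma sum_packets: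
  assumes "1 \<le> d" "3 \<le> n"
  shows "(\<Sum>k = 0..n. catalan_triangle n k * real (card (packet d n k))) =
    (\<Sum>xs\<in>suffix_data d n. catalan_triangle n (packet_index n xs))"
proof -
  have "(\<Sum>xs\<in>suffix_data d n. catalan_triangle n (packet_index n xs)) =
      (\<Sum>k = 0..n. \<Sum>xs\<in>{xs \<in> suffix_data d n. packet_index n xs = k}. catalan_triangle n (packet_index n xs))"
    using packet_index_le by (intro sum.group[symmetric] finite_suffix_data) auto
  also have "\<dots> = (\<Sum>k = 0..n. catalan_triangle n k * real (card (packet d n k)))"
  proof (rule sum.cong[OF HOL.refl])
    fix k assume "k \<in> {0..n}"
    have "(\<Sum>xs\<in>{xs \<in> suffix_data d n. packet_index n xs = k}. catalan_triangle n (packet_index n xs)) =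
        (\<Sum>xs\<in>{xs \<in> suffix_data d n. packet_index n xs = k}. catalan_triangle n k)"
      by (intro sum.cong HOL.refl) simp_all
    then show "(\<Sum>xs\<in>{xs \<in> suffix_data d n. packet_index n xs = k}. catalan_triangle n (packet_index n xs)) =
        catalan_triangle n k * real (card (packet d n k))"
      using card_packet[OF assms] \<open>k \<in> {0..n}\<close> by simp
  qed
  finally show ?thesis by simp
qed

definition suffixes_above :: "nat \<Rightarrow> nat \<Rightarrow> nat \<Rightarrow> (nat \<times> nat) list set" where
  "suffixes_above d n m = {xs \<in> suffix_data d n. \<forall>j\<in>snd ` set xs. m < j}"

lemma finite_suffixes_above [simp]: "finite (suffixes_above d n m)"
  using finite_suffix_data by (simp add: suffixes_above_def)

lemma card_Cons_blocks:
  "card ((\<lambda>(t, ys). (t, j) # ys) ` ({1..d - 1} \<times> A)) = (d - 1) * card A"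
  by (subst card_image) (auto simp: inj_on_def card_cartesian_product)

text \<open>Each of the \<open>n - m\<close> possible ends is either absent or carries one of \<open>d - 1\<close> exponents.\<close>

lemma card_suffixes_above:
  assumes "1 \<le> d" "m \<le> n"
  shows "card (suffixes_above d n m) = d ^ (n - m)"
  using assms(2)
proof (induction rule: inc_induct)
  case base
  have "xs = []" if "xs \<in> suffixes_above d n n" for xs
  proof (cases xs)
    case (Cons x ys)
    then show ?thesis using that by (cases x) (auto simp: suffixes_above_def suffix_data_Cons)
  qed
  then have "suffixes_above d n n = {[]}" by (auto simp: suffixes_above_def)
  then show ?case by simp
next
  case (step m)
  let ?S = "suffixes_above d n (Suc m)"
  let ?B = "(\<lambda>(t, ys). (t, Suc m) # ys) ` ({1..d - 1} \<times> ?S)"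
  have "xs \<in> suffixes_above d n m \<longleftrightarrow> xs \<in> ?S \<union> ?B" for xs
  proof (cases xs)
    case Nil
    then show ?thesis by (auto simp: suffixes_above_def)
  next
    case (Cons x ys)
    obtain t j where x: "x = (t, j)" by (cases x)
    show ?thesis using step.hyps
      by (fastforce simp: Cons x suffixes_above_def suffix_data_Cons image_iff)
  qed
  then have "suffixes_above d n m = ?S \<union> ?B" by blast
  moreover have "?S \<inter> ?B = {}" by (auto simp: suffixes_above_def)
  ultimately have "card (suffixes_above d n m) = card ?S + card ?B"
    by (simp add: card_Un_disjoint)
  then have "card (suffixes_above d n m) = d * d ^ (n - Suc m)"
    unfolding card_Cons_blocks step.IH using assms(1) by (cases d) (auto simp: algebra_simps)
  moreover have "n - m = Suc (n - Suc m)" using step.hyps by simp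
  ultimately show ?case by simp
qed

lemma card_single_blocks: "card (single_blocks d j) = d - 1"
  by (simp add: single_blocks_def card_image inj_on_def)

text \<open>The first block has \<open>d - 1\<close> exponents and is followed by a nonempty suffix with ends above
  \<open>j\<close>.\<close>

lemma card_several_blocks:
  assumes "1 \<le> d" "1 \<le> j" "j \<le> n"
  shows "card (several_blocks d n j) = (d - 1) * (d ^ (n - j) - 1)"
proof -
  have "xs \<in> several_blocks d n j \<longleftrightarrow>
      xs \<in> (\<lambda>(t, ys). (t, j) # ys) ` ({1..d - 1} \<times> (suffixes_above d n j - {[]}))" for xs
  proof (cases xs)
    case Nil
    then show ?thesis by (auto simp: several_blocks_def)
  next
    case (Cons x ys)
    obtain t i where x: "x = (t, i)" by (cases x)
    have "2 \<le> length xs \<longleftrightarrow> ys \<noteq> []" by (cases ys) (auto simp: Cons)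
    then show ?thesis using assms
      by (auto simp: Cons x several_blocks_def suffix_data_Cons suffixes_above_def image_iff)
  qed
  then have "several_blocks d n j =
      (\<lambda>(t, ys). (t, j) # ys) ` ({1..d - 1} \<times> (suffixes_above d n j - {[]}))" by blast
  moreover have "[] \<in> suffixes_above d n j" by (simp add: suffixes_above_def)
  ultimately show ?thesis
    using card_suffixes_above[OF assms(1,3)] by (simp only: card_Cons_blocks card_Diff_singleton)
qed

lemma card_packet_index:
  assumes "1 \<le> d" "3 \<le> n" "k \<le> n"
  shows "real (card {xs \<in> suffix_data d n. packet_index n xs = k}) =
    (if k = n then 1 else if k = n - 1 then 2 * (real d - 1)
     else (real d - 1) * real d ^ (n - 1 - k) - (if k = 0 then real d - 1 else 0))"
proof -
  have fin: "finite (single_blocks d j)" "finite (several_blocks d n j)" for j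
    using finite_suffix_data by (simp_all add: single_blocks_def several_blocks_def)
  have disj: "single_blocks d n \<inter> single_blocks d (n - 1) = {}"
    "single_blocks d i \<inter> several_blocks d n j = {}" for i j
    using assms by (auto simp: single_blocks_def several_blocks_def)
  have several: "real (card (several_blocks d n (k + 1))) = (real d - 1) * (real d ^ (n - 1 - k) - 1)"
    if "k < n - 1"
    using card_several_blocks[OF assms(1), of "k + 1" n] that assms(1) by (simp add: of_nat_diff)
  consider "k = 0" | "1 \<le> k" "k < n - 1" | "k = n - 1" | "k = n" using assms by linarith
  then show ?thesis
    unfolding packet_index_fibre[OF assms(2,3)]
  proof cases
    case 2
    then show "real (card (if k = n then {[]} else if k = n - 1 then single_blocks d n \<union> single_blocks d (n - 1)
        else (if k = 0 then {} else single_blocks d k) \<union> several_blocks d n (k + 1))) =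
      (if k = n then 1 else if k = n - 1 then 2 * (real d - 1)
       else (real d - 1) * real d ^ (n - 1 - k) - (if k = 0 then real d - 1 else 0))"
      using several assms(1) card_Un_disjoint[OF fin disj(2)] card_single_blocks[of d k]
      by (simp add: of_nat_diff algebra_simps)
  qed (use several assms card_Un_disjoint[OF fin(1) fin(1) disj(1)] in
      \<open>simp_all add: card_single_blocks of_nat_diff algebra_simps\<close>)
qed

theorem corollary4p12:
  fixes d n :: nat
  assumes "d \<ge> 1" and "n \<ge> 3"
  shows "real (card {g \<in> carrier (reflection_group d n). fully_commutative d n g})
      = (\<Sum>k = 0..n. catalan_triangle n k * real (card (packet d n k)))
    \<and> (\<Sum>k = 0..n. catalan_triangle n k * real (card (packet d n k)))
      = real d * (real d - 1) * poly (catalan_triangle_poly n (n - 2)) (real d)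
        + (2 * real d - 1) * catalan n - (real d - 1)"
proof
  show "real (card {g \<in> carrier (reflection_group d n). fully_commutative d n g})
      = (\<Sum>k = 0..n. catalan_triangle n k * real (card (packet d n k)))"
    using card_fully_commutative[of d n] sum_packets[OF assms] assms by simp
next
  let ?T = "catalan_triangle n" and ?d = "real d"
  obtain m where m: "n = Suc (Suc m)" "1 \<le> m"
    using assms(2) by (metis One_nat_def Suc_le_D Suc_le_mono numeral_3_eq_3)
  define c where "c k = real (card (packet d n k))" for k
  have c: "c k = (if k = n then 1 else if k = n - 1 then 2 * (?d - 1)
     else (?d - 1) * ?d ^ (n - 1 - k) - (if k = 0 then ?d - 1 else 0))" if "k \<le> n" for k
    using card_packet[OF assms that] card_packet_index[OF assms that] by (simp add: c_def)
  have diag: "?T (n - 1) = catalan n" "?T n = catalan n"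
    using catalan_triangle_diagonal[of "n - 1"] catalan_triangle_catalan[of n] assms by auto
  have "c (n - 1) = 2 * (?d - 1)" "c n = 1" using c[of "n - 1"] c[of n] assms by auto
  then have "(\<Sum>k = 0..n. ?T k * c k) =
      (\<Sum>k = 0..m. ?T k * c k) + (2 * (?d - 1) * ?T (n - 1) + ?T n)"
    by (simp add: m)
  also have "(\<Sum>k = 0..m. ?T k * c k) =
      (\<Sum>k = 0..m. ?T k * ((?d - 1) * (?d * ?d ^ (m - k))) - (if k = 0 then ?d - 1 else 0))"
  proof (rule sum.cong[OF HOL.refl])
    fix k assume "k \<in> {0..m}"
    then have "k \<le> m" by simp
    then have "n - 1 - k = Suc (m - k)" "k \<noteq> n" "k \<noteq> n - 1" "k \<le> n" using m by auto
    then show "?T k * c k = ?T k * ((?d - 1) * (?d * ?d ^ (m - k))) - (if k = 0 then ?d - 1 else 0)"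
      by (simp add: c catalan_triangle_0)
  qed
  also have "\<dots> = (\<Sum>k = 0..m. ?T k * ((?d - 1) * (?d * ?d ^ (m - k)))) - (?d - 1)"
    by (simp add: sum_subtractf)
  also have "(\<Sum>k = 0..m. ?T k * ((?d - 1) * (?d * ?d ^ (m - k)))) =
      ?d * (?d - 1) * poly (catalan_triangle_poly n (n - 2)) ?d"
    by (simp add: m catalan_triangle_poly_def poly_sum poly_monom sum_distrib_left algebra_simps)
  finally show "(\<Sum>k = 0..n. catalan_triangle n k * real (card (packet d n k))) =
      real d * (real d - 1) * poly (catalan_triangle_poly n (n - 2)) (real d)
        + (2 * real d - 1) * catalan n - (real d - 1)"
    unfolding c_def diag by (simp add: algebra_simps)
qed

end
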